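(* Let $\mathcal L$ be a linear line complex in $\mathbb{RP}^3$ and let a spatial hexagon in general position be given all of whose six (extended) edges belong to $\mathcal L$. Then the correlation $\kappa$ associated with the hexagon acts within $\mathcal L$, that is, $\kappa(\mathsf l)\in\mathcal L$ for every line $\mathsf l\in\mathcal L$. In particular, let $\mathsf c,\mathsf c_1,\mathsf c_2,\mathsf c_3,\mathsf c_{12},\mathsf c_{23},\mathsf c_{13}$ be seven oriented circles attached to seven vertices of an elementary cube which touch each other along the edges of the cube (i.e. $\mathsf c$ touches $\mathsf c_1,\mathsf c_2,\mathsf c_3$, and $\mathsf c_{ij}$ touches $\mathsf c_i$ and $\mathsf c_j$). Then the correlation associated with the hexagon $[\mathsf c_1,\mathsf c_{12},\mathsf c_2,\mathsf c_{23},\mathsf c_3,\mathsf c_{13}]$ maps $\mathsf c$ to a unique eighth oriented circle $\mathsf c_{123}$, which is in oriented contact with $\mathsf c_{12},\mathsf c_{23},\mathsf c_{13}$.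
   Context: Linear line complex: for a non-zero real skew-symmetric $4\times4$ matrix $\Lambda$, $\mathcal L$ is the set of all lines in $\mathbb{RP}^3$ such that $a^T\Lambda b=0$ for any two points $a,b$ (homogeneous coordinates) on the line. Associated correlation: consider a closed hexagon in $\mathbb{RP}^3$ with vertices $x^1,\dots,x^6$ (indices mod 6) in general position (no four vertices coplanar). Its edges are the lines $x^ix^{i+1}$, and $\pi^i$ denotes the plane spanned by $x^{i-1},x^i,x^{i+1}$. It is known that there is a unique correlation $\kappa$ of $\mathbb{RP}^3$, $\kappa(x)=\{y:y^TBx=0\}$ with $B=B^T$ invertible, such that $\kappa(x^i)=\pi^{i+3}$ for all $i$; it interchanges opposite edges of the hexagon. This is the correlation associated with the hexagon. The image of a line $\mathsf l$ under $\kappa$ is the line of intersection of the planes $\kappa(x)$, $x\in\mathsf l$. Oriented circles: the points $[V]$, $V=(x,y,a,b,r)$, of the Lie quadric $\langle V,V\rangle=0$ in $\mathbb{RP}^4$, with $\langle V,V'\rangle=xx'+yy'-\tfrac12(ab'+a'b)-rr'$: $(x,y,1,x^2+y^2-r^2,r)$ is the circle of centre $(x,y)$ and signed radius $r$ (a point if $r=0$), $(v,w,0,2d,1)$, $v^2+w^2=1$, an oriented line, $(0,0,0,1,0)$ the point at infinity. Circles touch (are in oriented contact) iff $\langle V,V'\rangle=0$. With Plücker coordinates $\gamma^{\mu\nu}=\alpha^\mu\beta^\nu-\alpha^\nu\beta^\mu$ of the line through points $\alpha,\beta$, the lines of the linear line complex $\gamma^{03}=\gamma^{12}$ are the points $(\gamma^{01},\gamma^{23},\gamma^{02},\gamma^{13},\gamma^{03})$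 of the quadric $2\gamma^{01}\gamma^{23}-2\gamma^{02}\gamma^{13}+2(\gamma^{03})^2=0$ of signature $(3,2)$; a fixed linear isometry identifies it with the Lie quadric, so that lines of this complex correspond bijectively to oriented circles and intersecting lines correspond to touching circles. The hexagon of the six circles is the spatial hexagon formed by the corresponding six lines $\mathsf l_1,\mathsf l_{12},\mathsf l_2,\mathsf l_{23},\mathsf l_3,\mathsf l_{13}$ (vertices are the intersections of consecutive lines), assumed to be in general position; the correlation acts on circles via this identification. *)

theory Defs
  imports "HOL-Analysis.Analysis"
begin

text \<open>
  Points, lines and planes of real projective 3-space are the linear subspaces of
  \<open>real ^ 4\<close> of dimension 1, 2 and 3. The elements of the numeral type \<open>4\<close> are
  0, 1, 2, 3, so that \<open>\<alpha> $ 0, \<dots>, \<alpha> $ 3\<close> are the homogeneous coordinates.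
  The numeral type \<open>6\<close> is the ring of integers mod 6; it indexes the vertices of hexagons.
\<close>

definition proj_point :: "(real ^ 4) set \<Rightarrow> bool" where
  "proj_point P \<longleftrightarrow> subspace P \<and> dim P = 1"

definition proj_line :: "(real ^ 4) set \<Rightarrow> bool" where
  "proj_line L \<longleftrightarrow> subspace L \<and> dim L = 2"

definition proj_plane :: "(real ^ 4) set \<Rightarrow> bool" where
  "proj_plane H \<longleftrightarrow> subspace H \<and> dim H = 3"

definition linear_line_complex :: "real ^ 4 ^ 4 \<Rightarrow> (real ^ 4) set set" where
  "linear_line_complex \<Lambda> = {L. proj_line L \<and> (\<forall>a\<in>L. \<forall>b\<in>L. a \<bullet> (\<Lambda> *v b) = 0)}"


subsection \<open>Hexagons and their associated correlations\<close>

definition hexagon_in_general_position :: "(6 \<Rightarrow> (real ^ 4) set) \<Rightarrow> bool" where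
  "hexagon_in_general_position x \<longleftrightarrow>
     (\<forall>i. proj_point (x i)) \<and>
     (\<forall>I. card I = 4 \<longrightarrow> \<not> (\<exists>H. proj_plane H \<and> (\<forall>i\<in>I. x i \<subseteq> H)))"

definition hexagon_edge :: "(6 \<Rightarrow> (real ^ 4) set) \<Rightarrow> 6 \<Rightarrow> (real ^ 4) set" where
  "hexagon_edge x i = span (x i \<union> x (i + 1))"

definition hexagon_plane :: "(6 \<Rightarrow> (real ^ 4) set) \<Rightarrow> 6 \<Rightarrow> (real ^ 4) set" where
  "hexagon_plane x i = span (x (i - 1) \<union> x i \<union> x (i + 1))"

definition matrix_correlation :: "real ^ 4 ^ 4 \<Rightarrow> (real ^ 4) set \<Rightarrow> (real ^ 4) set" where
  "matrix_correlation B P = {y. \<forall>x\<in>P. y \<bullet> (B *v x) = 0}"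

text \<open>
  Matrices that differ by a non-zero factor give the same function, so the description
  below refers to the correlation itself and not to a choice of its matrix.
\<close>

definition associated_correlation ::
    "(6 \<Rightarrow> (real ^ 4) set) \<Rightarrow> (real ^ 4) set \<Rightarrow> (real ^ 4) set" where
  "associated_correlation x =
     (THE \<kappa>. (\<exists>B. transpose B = B \<and> invertible B \<and> \<kappa> = matrix_correlation B) \<and>
             (\<forall>i. \<kappa> (x i) = hexagon_plane x (i + 3)))"

definition line_image ::
    "((real ^ 4) set \<Rightarrow> (real ^ 4) set) \<Rightarrow> (real ^ 4) set \<Rightarrow> (real ^ 4) set" where
  "line_image \<kappa> L = \<Inter> {\<kappa> P | P. proj_point P \<and> P \<subseteq> L}"


subsection \<open>Oriented circles\<close>

type_synonym real5 = "real \<times> real \<times> real \<times> real \<times> real"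

fun lie_form :: "real5 \<Rightarrow> real5 \<Rightarrow> real" where
  "lie_form (x, y, a, b, r) (x', y', a', b', r') =
     x * x' + y * y' - (a * b' + a' * b) / 2 - r * r'"

text \<open>
  Oriented circles in the sense of Lie geometry, i.e. all points of the Lie quadric:
  proper circles, points, oriented lines and the point at infinity.
\<close>

definition oriented_circle :: "real5 set \<Rightarrow> bool" where
  "oriented_circle C \<longleftrightarrow> subspace C \<and> dim C = 1 \<and> (\<forall>V\<in>C. lie_form V V = 0)"

definition touches :: "real5 set \<Rightarrow> real5 set \<Rightarrow> bool" where
  "touches C C' \<longleftrightarrow> (\<forall>V\<in>C. \<forall>V'\<in>C'. lie_form V V' = 0)"


subsection \<open>Oriented circles as lines of a linear line complex\<close>

definition pluecker :: "real ^ 4 \<Rightarrow> real ^ 4 \<Rightarrow> 4 \<Rightarrow> 4 \<Rightarrow> real" where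
  "pluecker \<alpha> \<beta> \<mu> \<nu> = \<alpha> $ \<mu> * \<beta> $ \<nu> - \<alpha> $ \<nu> * \<beta> $ \<mu>"

definition circle_complex :: "(real ^ 4) set set" where
  "circle_complex =
     {L. proj_line L \<and> (\<forall>\<alpha>\<in>L. \<forall>\<beta>\<in>L. pluecker \<alpha> \<beta> 0 3 = pluecker \<alpha> \<beta> 1 2)}"

definition complex_coords :: "real ^ 4 \<Rightarrow> real ^ 4 \<Rightarrow> real5" where
  "complex_coords \<alpha> \<beta> =
     (pluecker \<alpha> \<beta> 0 1, pluecker \<alpha> \<beta> 2 3, pluecker \<alpha> \<beta> 0 2, pluecker \<alpha> \<beta> 1 3, pluecker \<alpha> \<beta> 0 3)"

text \<open>The polarisation of \<open>2 p q - 2 s t + 2 u\<^sup>2\<close>.\<close>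

fun pluecker_form :: "real5 \<Rightarrow> real5 \<Rightarrow> real" where
  "pluecker_form (p, q, s, t, u) (p', q', s', t', u') =
     (p * q' + p' * q) - (s * t' + s' * t) + 2 * u * u'"

definition lie_isometry :: "(real5 \<Rightarrow> real5) \<Rightarrow> bool" where
  "lie_isometry \<phi> \<longleftrightarrow> linear \<phi> \<and> (\<forall>v w. lie_form (\<phi> v) (\<phi> w) = pluecker_form v w)"

lemma lie_isometry_exists: "\<exists>\<phi>. lie_isometry \<phi>"
proof -
  define \<phi> :: "real5 \<Rightarrow> real5" where
    "\<phi> = (\<lambda>(p, q, s, t, u). (sqrt 2 * u, (s - t) / sqrt 2, 2 * p, - q, (s + t) / sqrt 2))"
  have "linear \<phi>"
    by (rule linearI) (auto simp: \<phi>_def algebra_simps add_divide_distrib diff_divide_distrib)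
  moreover have "lie_form (\<phi> v) (\<phi> w) = pluecker_form v w" for v w
    by (cases v; cases w) (simp add: \<phi>_def field_simps)
  ultimately show ?thesis
    unfolding lie_isometry_def by blast
qed

text \<open>
  The Pluecker coordinates of a line are determined up to a common factor; running over all
  pairs of vectors of the line gives the corresponding point of projective 4-space.
\<close>

definition line_circle :: "(real5 \<Rightarrow> real5) \<Rightarrow> (real ^ 4) set \<Rightarrow> real5 set" where
  "line_circle \<phi> L = \<phi> ` span {complex_coords \<alpha> \<beta> | \<alpha> \<beta>. \<alpha> \<in> L \<and> \<beta> \<in> L}"

definition circle_line :: "(real5 \<Rightarrow> real5) \<Rightarrow> real5 set \<Rightarrow> (real ^ 4) set" where
  "circle_line \<phi> C = (THE L. L \<in> circle_complex \<and> line_circle \<phi> L = C)"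

definition cyclic6 :: "'a \<Rightarrow> 'a \<Rightarrow> 'a \<Rightarrow> 'a \<Rightarrow> 'a \<Rightarrow> 'a \<Rightarrow> 6 \<Rightarrow> 'a" where
  "cyclic6 a0 a1 a2 a3 a4 a5 =
     (\<lambda>i. if i = 0 then a0 else if i = 1 then a1 else if i = 2 then a2
          else if i = 3 then a3 else if i = 4 then a4 else a5)"

text \<open>
  The vertices are numbered so that the edge joining the vertices \<open>i\<close> and \<open>i + 1\<close> is the
  line corresponding to the circle \<open>C i\<close>.
\<close>

definition circle_hexagon :: "(real5 \<Rightarrow> real5) \<Rightarrow> (6 \<Rightarrow> real5 set) \<Rightarrow> 6 \<Rightarrow> (real ^ 4) set" where
  "circle_hexagon \<phi> C i = circle_line \<phi> (C (i - 1)) \<inter> circle_line \<phi> (C i)"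

definition maps_circle ::
    "(real5 \<Rightarrow> real5) \<Rightarrow> ((real ^ 4) set \<Rightarrow> (real ^ 4) set) \<Rightarrow> real5 set \<Rightarrow> real5 set \<Rightarrow> bool" where
  "maps_circle \<phi> \<kappa> C C' \<longleftrightarrow>
     oriented_circle C' \<and> line_image \<kappa> (circle_line \<phi> C) = circle_line \<phi> C'"

end

theory Submission
  imports Defs
begin

text \<open>
  In coordinates with the first four vertices of a hexagon as basis, the conditions on a symmetric
  matrix \<open>B\<close> of the associated correlation become a tridiagonal linear system with a
  one-dimensional solution space; likewise the skew matrices \<open>\<Lambda>\<close> whose complex contains all six
  edges are unique up to a factor. The lines \<open>l\<close> with \<open>\<kappa>(l)\<close> in the complex of \<open>\<Lambda>\<close> form the complex of
  \<open>B (*\<Lambda>) B\<close>, where \<open>*\<close> is the Hodge dual. Since \<open>\<kappa>\<close> interchanges opposite edges, that complex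
  contains the hexagon too, hence \<open>B (*\<Lambda>) B\<close> is a multiple of \<open>\<Lambda>\<close>.

  For circles, \<open>\<kappa>\<close> sends the lines of \<open>c\<close> and \<open>c\<^sub>1\<close>, which meet, to lines which meet, and the
  latter image is the opposite edge, that is, the line of \<open>c\<^sub>2\<^sub>3\<close>.
\<close>

subsection \<open>Coordinates\<close>

text \<open>\<open>forall_4\<close> and \<open>sum_4\<close> enumerate the indices as 1, 2, 3, 4. In
  the numeral type \<open>4\<close> the last of these is 0, and this turns them into enumerations of
  0, 1, 2, 3.\<close>

lemma four_eq_zero: "(4 :: 4) = 0"
  by simp

lemma add_6:
  "(0 :: 6) + 1 = 1" "(0 :: 6) + 2 = 2" "(0 :: 6) + 3 = 3"
  "(1 :: 6) + 1 = 2" "(1 :: 6) + 2 = 3" "(1 :: 6) + 3 = 4"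
  "(2 :: 6) + 1 = 3" "(2 :: 6) + 2 = 4" "(2 :: 6) + 3 = 5"
  "(3 :: 6) + 1 = 4" "(3 :: 6) + 2 = 5" "(3 :: 6) + 3 = 0"
  "(4 :: 6) + 1 = 5" "(4 :: 6) + 2 = 0" "(4 :: 6) + 3 = 1"
  "(5 :: 6) + 1 = 0" "(5 :: 6) + 2 = 1" "(5 :: 6) + 3 = 2"
  by simp_all

lemma forall_4_from_0: "(\<forall>i::4. P i) \<longleftrightarrow> P 0 \<and> P 1 \<and> P 2 \<and> P 3"
proof -
  have "P 4 \<longleftrightarrow> P 0"
    by (rule arg_cong[OF four_eq_zero])
  with forall_4[of P] show ?thesis
    by argo
qed

lemma exhaust_6:
  fixes i :: 6
  obtains "i = 0" | "i = 1" | "i = 2" | "i = 3" | "i = 4" | "i = 5"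
proof (induct i)
  case (of_int z)
  then have "z = 0 \<or> z = 1 \<or> z = 2 \<or> z = 3 \<or> z = 4 \<or> z = 5" by fastforce
  then show ?case using of_int by auto
qed

lemma forall_6: "(\<forall>i::6. P i) \<longleftrightarrow> P 0 \<and> P 1 \<and> P 2 \<and> P 3 \<and> P 4 \<and> P 5"
proof (intro iffI allI)
  fix i :: 6
  assume "P 0 \<and> P 1 \<and> P 2 \<and> P 3 \<and> P 4 \<and> P 5"
  then show "P i"
    by (cases i rule: exhaust_6) simp_all
qed simp

lemma sum_4_from_0: "sum f (UNIV :: 4 set) = f 0 + f 1 + f 2 + f 3"
  unfolding sum_4 four_eq_zero by (simp only: ac_simps)

definition vec4 :: "'a \<Rightarrow> 'a \<Rightarrow> 'a \<Rightarrow> 'a \<Rightarrow> 'a ^ 4" where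
  "vec4 a b c d = (\<chi> i. if i = 0 then a else if i = 1 then b else if i = 2 then c else d)"

lemma vec4_nth [simp]:
  "vec4 a b c d $ 0 = a" "vec4 a b c d $ 1 = b" "vec4 a b c d $ 2 = c" "vec4 a b c d $ 3 = d"
  by (simp_all add: vec4_def)

lemma vec_eq_iff_4: "(x :: 'a ^ 4) = y \<longleftrightarrow> x $ 0 = y $ 0 \<and> x $ 1 = y $ 1 \<and> x $ 2 = y $ 2 \<and> x $ 3 = y $ 3"
  by (simp add: vec_eq_iff forall_4_from_0)

lemma inner_4: "(x :: real ^ 4) \<bullet> y = x $ 0 * y $ 0 + x $ 1 * y $ 1 + x $ 2 * y $ 2 + x $ 3 * y $ 3"
  by (simp add: inner_vec_def sum_4_from_0)

lemma matrix_vector_mult_4: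
  "((A :: real ^ 4 ^ 'n) *v x) $ i = A $ i $ 0 * x $ 0 + A $ i $ 1 * x $ 1 + A $ i $ 2 * x $ 2 + A $ i $ 3 * x $ 3"
  by (simp add: matrix_vector_mult_def sum_4_from_0)

lemma inner_congruence:
  fixes P B :: "real ^ 'n ^ 'n"
  shows "(P *v x) \<bullet> (B *v (P *v y)) = x \<bullet> ((transpose P ** B ** P) *v y)"
  by (metis dot_lmul_matrix matrix_vector_mul_assoc vector_transpose_matrix)

lemma inner_symmetric_matrix:
  fixes B :: "real ^ 'n ^ 'n"
  assumes "transpose B = B"
  shows "x \<bullet> (B *v y) = y \<bullet> (B *v x)"
  by (metis assms dot_lmul_matrix inner_commute vector_transpose_matrix)

lemma inner_skew_matrix:
  fixes L :: "real ^ 'n ^ 'n"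
  assumes "transpose L = - L"
  shows "x \<bullet> (L *v y) = - (y \<bullet> (L *v x))"
proof -
  have "(- L) *v x = - (L *v x)"
    by (simp add: matrix_vector_mult_def vec_eq_iff sum_negf)
  then have "(x v* L) \<bullet> y = - (L *v x) \<bullet> y"
    using assms by (simp flip: transpose_matrix_vector)
  then show ?thesis
    by (simp add: dot_lmul_matrix inner_commute[of y])
qed

subsection \<open>Hexagons in normalised coordinates\<close>

text \<open>Linear independence in dual form: only the zero covector annihilates four of the
  vertices. This matches directly the condition that no plane contains four vertices.\<close>

definition any_four_independent :: "(6 \<Rightarrow> real ^ 4) \<Rightarrow> bool" where
  "any_four_independent v \<longleftrightarrow>
     (\<forall>n i j k l. distinct [i, j, k, l] \<and> n \<bullet> v i = 0 \<and> n \<bullet> v j = 0 \<and> n \<bullet> v k = 0 \<and> n \<bullet> v l = 0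
        \<longrightarrow> n = 0)"

text \<open>
  By symmetry of the matrix, orthogonality of \<open>v i\<close> and \<open>v (i + 4)\<close> is contained in the condition
  with offset 2.
\<close>

definition correlates_hexagon :: "(6 \<Rightarrow> real ^ 4) \<Rightarrow> real ^ 4 ^ 4 \<Rightarrow> bool" where
  "correlates_hexagon v B \<longleftrightarrow> transpose B = B \<and>
     (\<forall>i. v (i + 2) \<bullet> (B *v v i) = 0 \<and> v (i + 3) \<bullet> (B *v v i) = 0)"

definition complex_contains_hexagon :: "(6 \<Rightarrow> real ^ 4) \<Rightarrow> real ^ 4 ^ 4 \<Rightarrow> bool" where
  "complex_contains_hexagon v L \<longleftrightarrow> transpose L = - L \<and> (\<forall>i. v i \<bullet> (L *v v (i + 1)) = 0)"

lemma transpose_eq_self_iff_4: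
  fixes B :: "real ^ 4 ^ 4"
  shows "transpose B = B \<longleftrightarrow>
    B $ 1 $ 0 = B $ 0 $ 1 \<and> B $ 2 $ 0 = B $ 0 $ 2 \<and> B $ 3 $ 0 = B $ 0 $ 3 \<and>
    B $ 2 $ 1 = B $ 1 $ 2 \<and> B $ 3 $ 1 = B $ 1 $ 3 \<and> B $ 3 $ 2 = B $ 2 $ 3"
  by (auto simp: vec_eq_iff_4 transpose_def)

lemma transpose_eq_uminus_iff_4:
  fixes L :: "real ^ 4 ^ 4"
  shows "transpose L = - L \<longleftrightarrow>
    L $ 0 $ 0 = 0 \<and> L $ 1 $ 1 = 0 \<and> L $ 2 $ 2 = 0 \<and> L $ 3 $ 3 = 0 \<and>
    L $ 1 $ 0 = - L $ 0 $ 1 \<and> L $ 2 $ 0 = - L $ 0 $ 2 \<and> L $ 3 $ 0 = - L $ 0 $ 3 \<and>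
    L $ 2 $ 1 = - L $ 1 $ 2 \<and> L $ 3 $ 1 = - L $ 1 $ 3 \<and> L $ 3 $ 2 = - L $ 2 $ 3"
  by (auto simp: vec_eq_iff_4 transpose_def)

locale normalised_hexagon =
  fixes w :: "6 \<Rightarrow> real ^ 4"
  assumes four: "any_four_independent w"
    and w0: "w 0 = vec4 1 0 0 0" and w1: "w 1 = vec4 0 1 0 0"
    and w2: "w 2 = vec4 0 0 1 0" and w3: "w 3 = vec4 0 0 0 1"
begin

abbreviation a where "a \<equiv> ($) (w 4)"
abbreviation b where "b \<equiv> ($) (w 5)"
text \<open>These are the Pluecker coordinates of the edge joining \<open>w 4\<close> and
  \<open>w 5\<close>.\<close>

definition minor where "minor i j = a i * b j - a j * b i"

lemma normal_vector_zero:
  "distinct [i, j, k, l] \<Longrightarrow> n \<bullet> w i = 0 \<Longrightarrow> n \<bullet> w j = 0 \<Longrightarrow> n \<bullet> w k = 0 \<Longrightarrow> n \<bullet> w l = 0 \<Longrightarrow> n = 0"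
  using four unfolding any_four_independent_def by blast

text \<open>A vanishing coordinate would put \<open>w 4\<close> or \<open>w 5\<close> in the plane
  of three basis vertices. The five coordinates listed serve as divisors below.\<close>

lemma coords_nonzero: "a 0 \<noteq> 0" "a 1 \<noteq> 0" "a 2 \<noteq> 0" "b 2 \<noteq> 0" "b 3 \<noteq> 0"
  using normal_vector_zero[of 1 2 3 4 "vec4 1 0 0 0"] normal_vector_zero[of 0 2 3 4 "vec4 0 1 0 0"]
    normal_vector_zero[of 0 1 3 4 "vec4 0 0 1 0"] normal_vector_zero[of 0 1 3 5 "vec4 0 0 1 0"]
    normal_vector_zero[of 0 1 2 5 "vec4 0 0 0 1"]
  by (auto simp: inner_4 w0 w1 w2 w3 vec_eq_iff_4)

text \<open>Each normal vector supplied is nonzero and annihilates two basis vertices and one of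
  \<open>w 4\<close>, \<open>w 5\<close>. Its product with the other one is the minor up to
  sign.\<close>

lemma minors_nonzero: "minor 0 1 \<noteq> 0" "minor 1 2 \<noteq> 0" "minor 2 3 \<noteq> 0"
  using normal_vector_zero[of 2 3 4 5 "vec4 (a 1) (- a 0) 0 0"]
    normal_vector_zero[of 0 3 4 5 "vec4 0 (a 2) (- a 1) 0"]
    normal_vector_zero[of 0 1 4 5 "vec4 0 0 (b 3) (- b 2)"] coords_nonzero
  by (auto simp: inner_4 w0 w1 w2 w3 vec_eq_iff_4 minor_def algebra_simps)

text \<open>The hexagon has nine diagonals, each giving one linear equation for the ten entries of a
  symmetric matrix. The three diagonals between basis vertices make it tridiagonal.\<close>

lemma correlates_iff:
  "correlates_hexagon w T \<longleftrightarrow> transpose T = T \<and> T $ 0 $ 2 = 0 \<and> T $ 0 $ 3 = 0 \<and> T $ 1 $ 3 = 0 \<and>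
     T $ 0 $ 0 * a 0 + T $ 0 $ 1 * a 1 = 0 \<and>
     T $ 0 $ 1 * a 0 + T $ 1 $ 1 * a 1 + T $ 1 $ 2 * a 2 = 0 \<and>
     T $ 1 $ 2 * a 1 + T $ 2 $ 2 * a 2 + T $ 2 $ 3 * a 3 = 0 \<and>
     T $ 0 $ 1 * b 0 + T $ 1 $ 1 * b 1 + T $ 1 $ 2 * b 2 = 0 \<and>
     T $ 1 $ 2 * b 1 + T $ 2 $ 2 * b 2 + T $ 2 $ 3 * b 3 = 0 \<and>
     T $ 2 $ 3 * b 2 + T $ 3 $ 3 * b 3 = 0"
  unfolding correlates_hexagon_def
proof (rule conj_cong[OF refl])
  assume "transpose T = T"
  note sym = this[unfolded transpose_eq_self_iff_4]
  have e:
    "w 2 \<bullet> (T *v w 0) = T $ 0 $ 2"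
    "w 3 \<bullet> (T *v w 0) = T $ 0 $ 3"
    "w 3 \<bullet> (T *v w 1) = T $ 1 $ 3"
    "w 4 \<bullet> (T *v w 1) = T $ 0 $ 1 * a 0 + T $ 1 $ 1 * a 1 + T $ 1 $ 2 * a 2 + T $ 1 $ 3 * a 3"
    "w 4 \<bullet> (T *v w 2) = T $ 0 $ 2 * a 0 + T $ 1 $ 2 * a 1 + T $ 2 $ 2 * a 2 + T $ 2 $ 3 * a 3"
    "w 5 \<bullet> (T *v w 2) = T $ 0 $ 2 * b 0 + T $ 1 $ 2 * b 1 + T $ 2 $ 2 * b 2 + T $ 2 $ 3 * b 3"
    "w 5 \<bullet> (T *v w 3) = T $ 0 $ 3 * b 0 + T $ 1 $ 3 * b 1 + T $ 2 $ 3 * b 2 + T $ 3 $ 3 * b 3"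
    "w 0 \<bullet> (T *v w 3) = T $ 0 $ 3"
    "w 0 \<bullet> (T *v w 4) = T $ 0 $ 0 * a 0 + T $ 0 $ 1 * a 1 + T $ 0 $ 2 * a 2 + T $ 0 $ 3 * a 3"
    "w 1 \<bullet> (T *v w 4) = T $ 0 $ 1 * a 0 + T $ 1 $ 1 * a 1 + T $ 1 $ 2 * a 2 + T $ 1 $ 3 * a 3"
    "w 1 \<bullet> (T *v w 5) = T $ 0 $ 1 * b 0 + T $ 1 $ 1 * b 1 + T $ 1 $ 2 * b 2 + T $ 1 $ 3 * b 3"
    "w 2 \<bullet> (T *v w 5) = T $ 0 $ 2 * b 0 + T $ 1 $ 2 * b 1 + T $ 2 $ 2 * b 2 + T $ 2 $ 3 * b 3"
    by (simp_all add: sym inner_4 matrix_vector_mult_4 w0 w1 w2 w3)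
  show "(\<forall>i. w (i + 2) \<bullet> (T *v w i) = 0 \<and> w (i + 3) \<bullet> (T *v w i) = 0) \<longleftrightarrow>
     T $ 0 $ 2 = 0 \<and> T $ 0 $ 3 = 0 \<and> T $ 1 $ 3 = 0 \<and>
     T $ 0 $ 0 * a 0 + T $ 0 $ 1 * a 1 = 0 \<and>
     T $ 0 $ 1 * a 0 + T $ 1 $ 1 * a 1 + T $ 1 $ 2 * a 2 = 0 \<and>
     T $ 1 $ 2 * a 1 + T $ 2 $ 2 * a 2 + T $ 2 $ 3 * a 3 = 0 \<and>
     T $ 0 $ 1 * b 0 + T $ 1 $ 1 * b 1 + T $ 1 $ 2 * b 2 = 0 \<and>
     T $ 1 $ 2 * b 1 + T $ 2 $ 2 * b 2 + T $ 2 $ 3 * b 3 = 0 \<and>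
     T $ 2 $ 3 * b 2 + T $ 3 $ 3 * b 3 = 0"
    unfolding forall_6 add_6 e by auto
qed

lemma contains_iff:
  "complex_contains_hexagon w M \<longleftrightarrow> transpose M = - M \<and> M $ 0 $ 1 = 0 \<and> M $ 1 $ 2 = 0 \<and> M $ 2 $ 3 = 0 \<and>
     M $ 0 $ 3 * a 0 + M $ 1 $ 3 * a 1 = 0 \<and> M $ 0 $ 2 * b 2 + M $ 0 $ 3 * b 3 = 0 \<and>
     M $ 0 $ 2 * minor 0 2 + M $ 0 $ 3 * minor 0 3 + M $ 1 $ 3 * minor 1 3 = 0"
  unfolding complex_contains_hexagon_def
proof (rule conj_cong[OF refl])
  assume "transpose M = - M"
  note skew = this[unfolded transpose_eq_uminus_iff_4]
  have e:
    "w 0 \<bullet> (M *v w 1) = M $ 0 $ 1"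
    "w 1 \<bullet> (M *v w 2) = M $ 1 $ 2"
    "w 2 \<bullet> (M *v w 3) = M $ 2 $ 3"
    "w 3 \<bullet> (M *v w 4) = - (M $ 0 $ 3 * a 0 + M $ 1 $ 3 * a 1 + M $ 2 $ 3 * a 2)"
    "w 4 \<bullet> (M *v w 5) = M $ 0 $ 1 * minor 0 1 + M $ 0 $ 2 * minor 0 2 + M $ 0 $ 3 * minor 0 3 +
      M $ 1 $ 2 * minor 1 2 + M $ 1 $ 3 * minor 1 3 + M $ 2 $ 3 * minor 2 3"
    "w 5 \<bullet> (M *v w 0) = - (M $ 0 $ 1 * b 1 + M $ 0 $ 2 * b 2 + M $ 0 $ 3 * b 3)"
    by (simp_all add: skew inner_4 matrix_vector_mult_4 w0 w1 w2 w3 minor_def algebra_simps)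
  show "(\<forall>i. w i \<bullet> (M *v w (i + 1)) = 0) \<longleftrightarrow>
     M $ 0 $ 1 = 0 \<and> M $ 1 $ 2 = 0 \<and> M $ 2 $ 3 = 0 \<and>
     M $ 0 $ 3 * a 0 + M $ 1 $ 3 * a 1 = 0 \<and> M $ 0 $ 2 * b 2 + M $ 0 $ 3 * b 3 = 0 \<and>
     M $ 0 $ 2 * minor 0 2 + M $ 0 $ 3 * minor 0 3 + M $ 1 $ 3 * minor 1 3 = 0"
    unfolding forall_6 add_6 e by auto
qed

text \<open>Eliminating the diagonal entry from the two equations of row 1, and likewise of row 2,
  leaves \<open>T $ 0 $ 1 * minor 0 1 = T $ 1 $ 2 * minor 1 2 = T $ 2 $ 3 * minor 2 3\<close>. Here
  \<open>f\<close>, \<open>g\<close>, \<open>h\<close> solve this without denominators, and the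
  diagonal entries follow from one further equation per row.\<close>

definition corr_matrix :: "real ^ 4 ^ 4" where
  "corr_matrix = (let f = minor 1 2 * minor 2 3; g = minor 0 1 * minor 2 3; h = minor 0 1 * minor 1 2 in
     vec4 (vec4 (- f * a 1 / a 0) f 0 0)
          (vec4 f (- (f * a 0 + g * a 2) / a 1) g 0)
          (vec4 0 g (- (g * a 1 + h * a 3) / a 2) h)
          (vec4 0 0 h (- h * b 2 / b 3)))"

lemma correlates_corr_matrix: "correlates_hexagon w corr_matrix"
  unfolding correlates_iff transpose_eq_self_iff_4 corr_matrix_def Let_def
  using coords_nonzero by (auto simp: field_simps minor_def)

lemma correlates_unique:
  assumes "correlates_hexagon w T"
  shows "\<exists>c. T = c *\<^sub>R corr_matrix"
proof -
  note T = assms[unfolded correlates_iff transpose_eq_self_iff_4]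
  note nz = coords_nonzero minors_nonzero
  have e: "T $ 0 $ 1 * a 0 + T $ 1 $ 1 * a 1 + T $ 1 $ 2 * a 2 = 0"
     "T $ 0 $ 1 * b 0 + T $ 1 $ 1 * b 1 + T $ 1 $ 2 * b 2 = 0"
     "T $ 1 $ 2 * a 1 + T $ 2 $ 2 * a 2 + T $ 2 $ 3 * a 3 = 0"
     "T $ 1 $ 2 * b 1 + T $ 2 $ 2 * b 2 + T $ 2 $ 3 * b 3 = 0"
    using T by blast+
  have 1: "T $ 0 $ 1 * minor 0 1 = T $ 1 $ 2 * minor 1 2" 
    using e(1,2) unfolding minor_def by algebra
  have 2: "T $ 2 $ 3 * minor 2 3 = T $ 1 $ 2 * minor 1 2" 
    using e(3,4) unfolding minor_def by algebra
  \<comment> \<open>The factor is read off from entry (1, 2), where \<open>corr_matrix\<close> has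
    \<open>minor 0 1 * minor 2 3\<close>.\<close>
  define c where "c = T $ 1 $ 2 / (minor 0 1 * minor 2 3)"
  have g: "T $ 1 $ 2 = c * (minor 0 1 * minor 2 3)" using nz by (simp add: c_def)
  have f: "T $ 0 $ 1 = c * (minor 1 2 * minor 2 3)" using 1 nz by (simp add: g)
  have h: "T $ 2 $ 3 = c * (minor 0 1 * minor 1 2)" using 2 nz by (simp add: g)
  have "T $ 0 $ 0 = - T $ 0 $ 1 * a 1 / a 0" using T nz by (simp add: field_simps)
  moreover have "T $ 1 $ 1 = - (T $ 0 $ 1 * a 0 + T $ 1 $ 2 * a 2) / a 1" using T nz by (simp add: field_simps)
  moreover have "T $ 2 $ 2 = - (T $ 1 $ 2 * a 1 + T $ 2 $ 3 * a 3) / a 2" using T nz by (simp add: field_simps)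
  moreover have "T $ 3 $ 3 = - T $ 2 $ 3 * b 2 / b 3" using T nz by (simp add: field_simps)
  ultimately have "T = c *\<^sub>R corr_matrix"
    using T by (simp add: vec_eq_iff_4 corr_matrix_def Let_def f g h divide_simps; simp add: algebra_simps)
  then show ?thesis ..
qed

text \<open>The coordinates of \<open>w 4\<close> satisfy the equations of rows 0, 1 and 2. As the
  entries next to the diagonal do not vanish, these rows determine a kernel vector recursively from
  its first coordinate, so it is a multiple of \<open>w 4\<close>. Row 3 annihilates
  \<open>w 5\<close>, and \<open>minor 2 3\<close> being nonzero forces the multiple to be
  zero.\<close>

lemma invertible_corr_matrix: "invertible corr_matrix"
proof -
  let ?T = corr_matrix
  note T = correlates_corr_matrix[unfolded correlates_iff transpose_eq_self_iff_4]
  note nz = coords_nonzero minors_nonzero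
  have f: "?T $ 0 $ 1 \<noteq> 0" and g: "?T $ 1 $ 2 \<noteq> 0" and h: "?T $ 2 $ 3 \<noteq> 0" 
    using nz by (simp_all add: corr_matrix_def Let_def)
  have "k = 0" if "?T *v k = 0" for k
  proof -
    from that have k: 
      "?T $ 0 $ 0 * k $ 0 + ?T $ 0 $ 1 * k $ 1 = 0"
      "?T $ 0 $ 1 * k $ 0 + ?T $ 1 $ 1 * k $ 1 + ?T $ 1 $ 2 * k $ 2 = 0"
      "?T $ 1 $ 2 * k $ 1 + ?T $ 2 $ 2 * k $ 2 + ?T $ 2 $ 3 * k $ 3 = 0"
      "?T $ 2 $ 3 * k $ 2 + ?T $ 3 $ 3 * k $ 3 = 0"
      using T by (simp_all add: vec_eq_iff_4 matrix_vector_mult_4)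
    define t where "t = k $ 0 / a 0"
    have k0: "k $ 0 = t * a 0" using nz by (simp add: t_def)
    have "?T $ 0 $ 1 * (k $ 1 - t * a 1) = 0" using k(1) k0 T by algebra
    then have k1: "k $ 1 = t * a 1" using f by simp
    have "?T $ 1 $ 2 * (k $ 2 - t * a 2) = 0" using k(2) k0 k1 T by algebra
    then have k2: "k $ 2 = t * a 2" using g by simp
    have "?T $ 2 $ 3 * (k $ 3 - t * a 3) = 0" using k(3) k1 k2 T by algebra
    then have k3: "k $ 3 = t * a 3" using h by simp
    have "t * ?T $ 2 $ 3 * minor 2 3 = 0" using k(4) k2 k3 T unfolding minor_def by algebra
    then have "t = 0" using h nz by simp
    then show ?thesis using k0 k1 k2 k3 by (simp add: vec_eq_iff_4)
  qed
  then show ?thesis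
    by (metis invertible_left_inverse matrix_left_invertible_ker)
qed

text \<open>The edges from \<open>w 3\<close> to \<open>w 4\<close> and from \<open>w 5\<close> to
  \<open>w 0\<close> express all remaining entries by entry (0, 3), which is thus nonzero for
  nonzero \<open>L\<close> and fixes the factor.\<close>

lemma complex_unique:
  assumes "complex_contains_hexagon w L" "complex_contains_hexagon w M" "L \<noteq> 0"
  shows "\<exists>c. M = c *\<^sub>R L"
proof -
  note L = assms(1)[unfolded contains_iff transpose_eq_uminus_iff_4]
  note M = assms(2)[unfolded contains_iff transpose_eq_uminus_iff_4]
  note nz = coords_nonzero
  have L': "L $ 0 $ 2 = - L $ 0 $ 3 * b 3 / b 2" "L $ 1 $ 3 = - L $ 0 $ 3 * a 0 / a 1" 
    using L nz by (simp_all add: field_simps)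
  have M': "M $ 0 $ 2 = - M $ 0 $ 3 * b 3 / b 2" "M $ 1 $ 3 = - M $ 0 $ 3 * a 0 / a 1" 
    using M nz by (simp_all add: field_simps)
  have "L $ 0 $ 3 \<noteq> 0"
    using assms(3) L L' by (auto simp: vec_eq_iff_4)
  then have "M = (M $ 0 $ 3 / L $ 0 $ 3) *\<^sub>R L"
    using L M L' M' by (simp add: vec_eq_iff_4)
  then show ?thesis ..
qed

end

subsection \<open>Change of basis\<close>

lemma matrix_eqI_inner:
  fixes A B :: "real ^ 'n ^ 'm"
  assumes "\<And>x y. x \<bullet> (A *v y) = x \<bullet> (B *v y)"
  shows "A = B"
proof -
  have "A *v y = B *v y" for y
    using assms by (metis vector_eq_ldot)
  then show ?thesis
    by (simp add: matrix_eq)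
qed

text \<open>\<open>P\<close> has the vertices 0 to 3 as columns, \<open>Q\<close> is its inverse,
  and \<open>w\<close> lists the vertices in the new coordinates.\<close>

lemma normalise_hexagon:
  assumes "any_four_independent v"
  obtains P :: "real ^ 4 ^ 4" and w and Q :: "real ^ 4 ^ 4"
  where "\<And>i. v i = P *v w i" "\<And>i. w i = Q *v v i" "P ** Q = mat 1" "normalised_hexagon w"
proof -
  define R :: "real ^ 4 ^ 4" where "R = vec4 (v 0) (v 1) (v 2) (v 3)"
  define P where "P = transpose R"
  have "n = 0" if "R *v n = 0" for n
  proof -
    have "n \<bullet> v 0 = 0" "n \<bullet> v 1 = 0" "n \<bullet> v 2 = 0" "n \<bullet> v 3 = 0"
      using that by (simp_all add: vec_eq_iff_4 matrix_vector_mult_4 R_def inner_4 mult.commute)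
    then show ?thesis
      using assms[unfolded any_four_independent_def, rule_format, of 0 1 2 3 n] by simp
  qed
  then have "invertible R"
    by (simp add: invertible_left_inverse matrix_left_invertible_ker)
  then have "invertible P"
    unfolding P_def by (rule transpose_invertible)
  then obtain Q where Q: "P ** Q = mat 1" "Q ** P = mat 1"
    unfolding invertible_def by blast
  define w where "w i = Q *v v i" for i
  have v: "v i = P *v w i" for i
    by (simp add: w_def matrix_vector_mul_assoc Q)
  have QP: "x = Q *v y" if "y = P *v x" for x y
    by (simp add: that matrix_vector_mul_assoc Q)
  have "any_four_independent w"
    unfolding any_four_independent_def
  proof (intro allI impI)
    fix n i j k l
    assume *: "distinct [i, j, k, l] \<and> n \<bullet> w i = 0 \<and> n \<bullet> w j = 0 \<and> n \<bullet> w k = 0 \<and> n \<bullet> w l = 0"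
    \<comment> \<open>Covectors transform the opposite way: if \<open>n\<close> annihilates
      \<open>Q *v v i\<close>, then \<open>n v* Q\<close> annihilates \<open>v i\<close>.\<close>
    then have "n v* Q = 0"
      using assms[unfolded any_four_independent_def, rule_format, of i j k l "n v* Q"]
      by (simp add: w_def dot_lmul_matrix)
    then have "(n v* Q) v* P = 0"
      by simp
    then show "n = 0"
      by (simp add: vector_matrix_mul_assoc Q)
  qed
  moreover have vP: "v 0 = P *v vec4 1 0 0 0" "v 1 = P *v vec4 0 1 0 0"
      "v 2 = P *v vec4 0 0 1 0" "v 3 = P *v vec4 0 0 0 1"
    unfolding vec_eq_iff_4 matrix_vector_mult_4 by (simp_all add: P_def R_def transpose_def)
  ultimately have "normalised_hexagon w"
    using QP[OF vP(1)] QP[OF vP(2)] QP[OF vP(3)] QP[OF vP(4)]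
    unfolding normalised_hexagon_def w_def by simp
  with v Q show ?thesis
    using that[of P w Q] by (simp add: w_def)
qed

lemma correlates_congruence:
  assumes "correlates_hexagon v B" "\<And>i. v i = P *v w i"
  shows "correlates_hexagon w (transpose P ** B ** P)"
  using assms unfolding correlates_hexagon_def
  by (simp add: inner_congruence matrix_transpose_mul matrix_mul_assoc del: transpose_matrix_vector)

lemma transpose_congruence_skew:
  fixes L P :: "real ^ 'n ^ 'n"
  assumes "transpose L = - L"
  shows "transpose (transpose P ** L ** P) = - (transpose P ** L ** P)"
proof (rule matrix_eqI_inner)
  fix x y
  let ?M = "transpose P ** L ** P"
  have "x \<bullet> (transpose ?M *v y) = y \<bullet> (?M *v x)"
    by (simp add: dot_lmul_matrix inner_commute[of x])
  also have "\<dots> = - (x \<bullet> (?M *v y))"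
    unfolding inner_congruence[symmetric] by (rule inner_skew_matrix[OF assms])
  also have "\<dots> = x \<bullet> (- ?M *v y)"
    by (simp add: matrix_vector_mult_def inner_vec_def sum_negf)
  finally show "x \<bullet> (transpose ?M *v y) = x \<bullet> (- ?M *v y)" .
qed

lemma contains_congruence:
  assumes "complex_contains_hexagon v L" "\<And>i. v i = P *v w i"
  shows "complex_contains_hexagon w (transpose P ** L ** P)"
  using assms transpose_congruence_skew[of L P] unfolding complex_contains_hexagon_def
  by (simp add: inner_congruence)

text \<open>Congruence by \<open>Q\<close> carries the normalised solution over to \<open>v\<close>,
  and congruence by \<open>P\<close> takes any solution for \<open>v\<close> to the normalised
  hexagon, where it is a multiple of \<open>corr_matrix\<close>.\<close>

lemma correlation_matrix_unique:
  assumes "any_four_independent v"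
  shows "\<exists>B0. correlates_hexagon v B0 \<and> invertible B0 \<and> (\<forall>B. correlates_hexagon v B \<longrightarrow> (\<exists>c. B = c *\<^sub>R B0))"
proof -
  obtain P :: "real ^ 4 ^ 4" and w and Q :: "real ^ 4 ^ 4"
    where v: "\<And>i. v i = P *v w i" and w: "\<And>i. w i = Q *v v i" and PQ: "P ** Q = mat 1"
      and nw: "normalised_hexagon w"
    by (rule normalise_hexagon[OF assms], rule that, assumption+)
  interpret normalised_hexagon w by (fact nw)
  let ?B = "transpose Q ** corr_matrix ** Q"
  have invQ: "invertible Q"
    using PQ invertible_left_inverse by blast
  have PQv: "P *v (Q *v x) = x" for x
    by (simp add: matrix_vector_mul_assoc PQ)
  have "correlates_hexagon v ?B"
    using correlates_corr_matrix w by (rule correlates_congruence)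
  moreover have "invertible ?B"
    by (intro invertible_mult transpose_invertible invQ invertible_corr_matrix)
  moreover have "\<exists>c. B = c *\<^sub>R ?B" if B: "correlates_hexagon v B" for B
  proof -
    obtain c where c: "transpose P ** B ** P = c *\<^sub>R corr_matrix"
      using correlates_unique[OF correlates_congruence[OF B v]] by blast
    have "B = c *\<^sub>R ?B"
    proof (rule matrix_eqI_inner)
      fix x y
      have "x \<bullet> (B *v y) = (P *v (Q *v x)) \<bullet> (B *v (P *v (Q *v y)))"
        by (simp only: PQv)
      also have "\<dots> = c * ((Q *v x) \<bullet> (corr_matrix *v (Q *v y)))"
        by (simp only: inner_congruence[of P] c flip: scaleR_matrix_vector_assoc) simp
      also have "\<dots> = x \<bullet> ((c *\<^sub>R ?B) *v y)"
        by (simp only: inner_congruence flip: scaleR_matrix_vector_assoc) simp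
      finally show "x \<bullet> (B *v y) = x \<bullet> ((c *\<^sub>R ?B) *v y)" .
    qed
    then show ?thesis ..
  qed
  ultimately show ?thesis by blast
qed

lemma complex_matrix_unique:
  assumes "any_four_independent v" "complex_contains_hexagon v L" "complex_contains_hexagon v M" "L \<noteq> 0"
  shows "\<exists>c. M = c *\<^sub>R L"
proof -
  obtain P :: "real ^ 4 ^ 4" and w and Q :: "real ^ 4 ^ 4"
    where v: "\<And>i. v i = P *v w i" and "\<And>i. w i = Q *v v i" and PQ: "P ** Q = mat 1"
      and nw: "normalised_hexagon w"
    by (rule normalise_hexagon[OF assms(1)], rule that, assumption+)
  interpret normalised_hexagon w by (fact nw)
  have PQv: "P *v (Q *v x) = x" for x
    by (simp add: matrix_vector_mul_assoc PQ)
  have PQ': "x \<bullet> (A *v y) = (Q *v x) \<bullet> ((transpose P ** A ** P) *v (Q *v y))" for x y and A :: "real ^ 4 ^ 4"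
    by (simp only: PQv flip: inner_congruence)
  have "transpose P ** L ** P \<noteq> 0"
  proof
    assume "transpose P ** L ** P = 0"
    then have "L = 0"
      by (intro matrix_eqI_inner) (simp add: PQ'[of _ L])
    with assms(4) show False ..
  qed
  then obtain c where c: "transpose P ** M ** P = c *\<^sub>R (transpose P ** L ** P)"
    using complex_unique contains_congruence[OF assms(2) v] contains_congruence[OF assms(3) v] by blast
  have "M = c *\<^sub>R L"
  proof (rule matrix_eqI_inner)
    fix x y
    have "x \<bullet> (M *v y) = c * (x \<bullet> (L *v y))"
      unfolding PQ'[of _ M] PQ'[of _ L] c by (simp flip: scaleR_matrix_vector_assoc)
    then show "x \<bullet> (M *v y) = x \<bullet> ((c *\<^sub>R L) *v y)"
      by (simp flip: scaleR_matrix_vector_assoc)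
  qed
  then show ?thesis ..
qed

subsection \<open>Points, lines and correlations\<close>

lemma dim_insert_le: "dim (insert (x :: 'a :: euclidean_space) S) \<le> dim S + 1"
  by (simp add: dim_insert)

lemma subspace_dim_1E:
  fixes S :: "'a :: euclidean_space set"
  assumes "subspace S" "dim S = 1"
  obtains v where "v \<noteq> 0" "S = span {v}"
proof -
  obtain B where B: "B \<subseteq> S" "independent B" "S \<subseteq> span B" "card B = dim S"
    using basis_exists by blast
  from B(4) assms(2) obtain v where v: "B = {v}"
    by (auto simp: card_1_singleton_iff)
  have "v \<noteq> 0"
    using B(2) v dependent_zero by blast
  moreover have "S = span {v}"
    using B(1,3) v assms(1) span_minimal by blast
  ultimately show ?thesis
    by (rule that)
qed

lemma proj_point_span: "v \<noteq> 0 \<Longrightarrow> proj_point (span {v})"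
  by (simp add: proj_point_def)

lemma proj_line_span_iff: "proj_line (span {p, q}) \<longleftrightarrow> dim {p, q} = 2"
  by (simp add: proj_line_def)

lemma proj_lineE:
  assumes "proj_line L"
  obtains p q where "L = span {p, q}" "dim {p, q} = 2"
proof -
  from assms have L: "subspace L" "dim L = 2"
    by (auto simp: proj_line_def)
  obtain B where B: "B \<subseteq> L" "independent B" "L \<subseteq> span B" "card B = dim L"
    using basis_exists by blast
  from B(4) L(2) obtain p q where pq: "B = {p, q}"
    by (auto simp: card_2_iff)
  moreover have "L = span B"
    using B L span_minimal by blast
  ultimately show ?thesis
    using that[of p q] L(2) by simp
qed

lemma proj_line_eqI:
  assumes "proj_line L" "p \<in> L" "q \<in> L" "dim {p, q} = 2"
  shows "L = span {p, q}"
  using assms subspace_dim_equal[of "span {p, q}" L]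
  by (simp add: proj_line_def span_minimal)

lemma proj_line_through:
  assumes "proj_line L" "p \<in> L" "p \<noteq> 0"
  obtains q where "L = span {p, q}" "dim {p, q} = 2"
proof -
  from assms have L: "subspace L" "dim L = 2"
    by (auto simp: proj_line_def)
  have "\<not> L \<subseteq> span {p}"
    using dim_subset[of L "span {p}"] L(2) assms(3) by auto
  then obtain q where q: "q \<in> L" "q \<notin> span {p}"
    by blast
  then have "dim {q, p} = 2"
    using assms(3) by (simp add: dim_insert[of q])
  then have "dim {p, q} = 2"
    by (simp add: insert_commute)
  with assms q that proj_line_eqI show ?thesis
    by blast
qed

section \<open>Vertices in general position\<close>

lemma any_four_independent_dim:
  assumes "any_four_independent v" "distinct [i, j, k, l]"
  shows "dim {v i, v j, v k, v l} = 4"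
proof (rule ccontr)
  assume "dim {v i, v j, v k, v l} \<noteq> 4"
  moreover have "dim {v i, v j, v k, v l} \<le> 4"
    using dim_subset_UNIV[of "{v i, v j, v k, v l}"] by simp
  ultimately have "dim {v i, v j, v k, v l} < DIM(real ^ 4)"
    by simp
  then obtain n where "n \<noteq> 0" and n: "span {v i, v j, v k, v l} \<subseteq> {x. n \<bullet> x = 0}"
    using lowdim_subset_hyperplane by blast
  have "n \<bullet> v i = 0" "n \<bullet> v j = 0" "n \<bullet> v k = 0" "n \<bullet> v l = 0"
    using n span_base[of _ "{v i, v j, v k, v l}"] by auto
  with assms \<open>n \<noteq> 0\<close> show False
    unfolding any_four_independent_def by blast
qed

text \<open>Six vertices leave room for a fourth one, and removing it from a set of dimension 4
  lowers the dimension by at most one.\<close>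

lemma any_four_independent_dim3:
  assumes "any_four_independent v" "distinct [i, j, k]"
  shows "dim {v i, v j, v k} = 3"
proof -
  have "card {i, j, k} = 3"
    using assms(2) by simp
  then have "card {i, j, k} \<noteq> CARD(6)"
    by simp
  then have "{i, j, k} \<noteq> UNIV"
    by auto
  then obtain l where "l \<notin> {i, j, k}"
    by blast
  then have "dim (insert (v l) {v i, v j, v k}) = 4"
    using any_four_independent_dim[OF assms(1), of l i j k] assms(2) by auto
  then have "3 \<le> dim {v i, v j, v k}"
    using dim_insert_le[of "v l" "{v i, v j, v k}"] by linarith
  moreover have "dim {v i, v j, v k} \<le> card {v i, v j, v k}"
    by (rule dim_le_card') simp
  moreover have "card {v i, v j, v k} \<le> 3"
    by (simp add: card_insert_if)
  ultimately show ?thesis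
    by linarith
qed

lemma any_four_independent_dim2:
  assumes "any_four_independent v" "i \<noteq> j"
  shows "dim {v i, v j} = 2"
proof -
  have "card {i, j} = 2"
    using assms(2) by simp
  then have "card {i, j} \<noteq> CARD(6)"
    by simp
  then have "{i, j} \<noteq> UNIV"
    by auto
  then obtain l where "l \<notin> {i, j}"
    by blast
  then have "dim (insert (v l) {v i, v j}) = 3"
    using any_four_independent_dim3[OF assms(1), of l i j] assms(2) by auto
  then have "2 \<le> dim {v i, v j}"
    using dim_insert_le[of "v l" "{v i, v j}"] by linarith
  moreover have "dim {v i, v j} \<le> card {v i, v j}"
    by (rule dim_le_card') simp
  moreover have "card {v i, v j} \<le> 2"
    by (simp add: card_insert_if)
  ultimately show ?thesis
    by linarith
qed

text \<open>A nonzero vector orthogonal to four representatives would be the normal of a plane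
  through four vertices.\<close>

lemma hexagon_vertices:
  assumes "hexagon_in_general_position x"
  obtains v where "\<And>i. x i = span {v i}" "any_four_independent v"
proof -
  have "\<forall>i. \<exists>v. x i = span {v}"
    using assms unfolding hexagon_in_general_position_def proj_point_def by (meson subspace_dim_1E)
  then obtain v where v: "\<And>i. x i = span {v i}"
    by metis
  have "any_four_independent v"
    unfolding any_four_independent_def
  proof (intro allI impI, rule ccontr)
    fix n i j k l
    assume *: "distinct [i, j, k, l] \<and> n \<bullet> v i = 0 \<and> n \<bullet> v j = 0 \<and> n \<bullet> v k = 0 \<and> n \<bullet> v l = 0"
      and "n \<noteq> 0"
    let ?H = "{y. n \<bullet> y = 0}"
    have "proj_plane ?H"
      using \<open>n \<noteq> 0\<close> by (simp add: proj_plane_def subspace_hyperplane dim_hyperplane)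
    moreover have "\<forall>m\<in>{i, j, k, l}. x m \<subseteq> ?H"
      unfolding v using * by (intro ballI span_minimal subspace_hyperplane) auto
    moreover have "card {i, j, k, l} = 4"
      using * by simp
    ultimately show False
      using assms unfolding hexagon_in_general_position_def by blast
  qed
  with v that show ?thesis
    by blast
qed

section \<open>Correlations given by matrices\<close>

lemma matrix_correlation_span:
  "matrix_correlation B (span S) = {y. \<forall>x\<in>S. y \<bullet> (B *v x) = 0}"
proof (intro subset_antisym subsetI)
  fix y
  assume y: "y \<in> {y. \<forall>x\<in>S. y \<bullet> (B *v x) = 0}"
  have "span S \<subseteq> {x. (y v* B) \<bullet> x = 0}"
    using y by (intro span_minimal subspace_hyperplane) (auto simp: dot_lmul_matrix)
  then show "y \<in> matrix_correlation B (span S)"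
    by (auto simp: matrix_correlation_def dot_lmul_matrix)
qed (auto simp: matrix_correlation_def span_base)

lemma subspace_matrix_correlation: "subspace (matrix_correlation B S)"
  by (auto simp: subspace_def matrix_correlation_def inner_add_left)

lemma invertible_imp_inj: "invertible (B :: real ^ 'n ^ 'n) \<Longrightarrow> inj ((*v) B)"
  by (simp add: inj_matrix_vector_mult)

lemma dim_image_invertible:
  fixes B :: "real ^ 'n ^ 'n"
  assumes "invertible B"
  shows "dim ((*v) B ` S) = dim S"
  using assms inj_on_subset[OF invertible_imp_inj] by (intro dim_image_eq) auto

text \<open>The correlation takes \<open>S\<close> to the orthogonal complement of its image under
  \<open>B\<close>, and an invertible \<open>B\<close> preserves dimension.\<close>

lemma dim_matrix_correlation:
  assumes "subspace S" "invertible B"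
  shows "dim (matrix_correlation B S) + dim S = 4"
proof -
  have "subspace ((*v) B ` S)"
    using assms(1) by (simp add: linear_subspace_image)
  from dim_subspace_orthogonal_to_vectors[OF this subspace_UNIV subset_UNIV]
  have "dim {y. \<forall>x\<in>S. orthogonal (B *v x) y} + dim S = 4"
    by (simp add: dim_image_invertible[OF assms(2)])
  moreover have "{y. \<forall>x\<in>S. orthogonal (B *v x) y} = matrix_correlation B S"
    by (auto simp: matrix_correlation_def orthogonal_def inner_commute)
  ultimately show ?thesis by simp
qed

lemma proj_line_matrix_correlation:
  "proj_line L \<Longrightarrow> invertible B \<Longrightarrow> proj_line (matrix_correlation B L)"
  using dim_matrix_correlation[of L B] subspace_matrix_correlation by (simp add: proj_line_def)

lemma line_image_matrix_correlation:
  assumes "subspace L"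
  shows "line_image (matrix_correlation B) L = matrix_correlation B L"
proof (intro subset_antisym subsetI)
  fix y assume y: "y \<in> line_image (matrix_correlation B) L"
  have "y \<bullet> (B *v x) = 0" if "x \<in> L" for x
  \<comment> \<open>The zero vector spans no projective point, but the condition it imposes is
    trivial.\<close>
  proof (cases "x = 0")
    case False
    have "span {x} \<subseteq> L"
      using that assms by (simp add: span_minimal)
    then have "y \<in> matrix_correlation B (span {x})"
      using y proj_point_span[OF False] by (auto simp: line_image_def)
    then show ?thesis
      by (simp add: matrix_correlation_span)
  qed simp
  then show "y \<in> matrix_correlation B L"
    by (simp add: matrix_correlation_def)
qed (auto simp: line_image_def matrix_correlation_def)

lemma hexagon_index_simps: "i + 3 - 1 = i + (2::6)" "i + 3 + 1 = i + (4::6)" "i + 4 + 2 = (i::6)" "i + 3 + 3 = (i::6)"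
    "i + 1 + 3 = i + (4 :: 6)" "i + 1 + 2 = i + (3 :: 6)"
  by (simp_all add: algebra_simps)

text \<open>The image of a vertex and the opposite hexagon plane both have dimension 3, so they
  agree once the three spanning vertices satisfy the orthogonality conditions.\<close>

lemma matrix_correlation_vertex_iff:
  assumes v: "any_four_independent v" and x: "\<And>i. x i = span {v i}"
    and B: "transpose B = B" "invertible B"
  shows "(\<forall>i. matrix_correlation B (x i) = hexagon_plane x (i + 3)) \<longleftrightarrow> correlates_hexagon v B"
proof -
  have hp: "hexagon_plane x (i + 3) = span {v (i + 2), v (i + 3), v (i + 4)}" for i
  proof -
    have "hexagon_plane x (i + 3) = span (\<Union>j\<in>{i + 2, i + 3, i + 4}. span {v j})"
      unfolding hexagon_plane_def x hexagon_index_simps by (simp add: Un_assoc)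
    also have "\<dots> = span {v (i + 2), v (i + 3), v (i + 4)}"
    proof (rule span_eq[THEN iffD2], intro conjI)
      show "(\<Union>j\<in>{i + 2, i + 3, i + 4}. span {v j}) \<subseteq> span {v (i + 2), v (i + 3), v (i + 4)}"
        by (auto intro: span_mono[THEN subsetD, rotated])
      show "{v (i + 2), v (i + 3), v (i + 4)} \<subseteq> span (\<Union>j\<in>{i + 2, i + 3, i + 4}. span {v j})"
        by (auto intro!: span_base)
    qed
    finally show ?thesis .
  qed
  have d3: "dim (span {v (i + 2), v (i + 3), v (i + 4)}) = 3" for i
    using any_four_independent_dim3[OF v, of "i + 2" "i + 3" "i + 4"] by simp
  have eq_iff: "matrix_correlation B (x i) = span {v (i + 2), v (i + 3), v (i + 4)} \<longleftrightarrow>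
      v (i + 2) \<bullet> (B *v v i) = 0 \<and> v (i + 3) \<bullet> (B *v v i) = 0 \<and> v (i + 4) \<bullet> (B *v v i) = 0"
    (is "?l \<longleftrightarrow> ?r") for i
  proof
    assume ?l
    then have "{v (i + 2), v (i + 3), v (i + 4)} \<subseteq> matrix_correlation B (x i)"
      using span_superset by metis
    then show ?r
      by (simp add: x matrix_correlation_span)
  next
    assume ?r
    then have "span {v (i + 2), v (i + 3), v (i + 4)} \<subseteq> matrix_correlation B (x i)"
      by (intro span_minimal subspace_matrix_correlation) (simp add: x matrix_correlation_span)
    moreover have "dim (matrix_correlation B (x i)) \<le> dim (span {v (i + 2), v (i + 3), v (i + 4)})"
    proof -
      have "dim {v i, v (i + 1)} = 2"
        by (rule any_four_independent_dim2[OF v]) simp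
      then have "v i \<noteq> 0"
        by (auto simp: dim_insert span_zero split: if_splits)
      then show ?thesis
        using dim_matrix_correlation[of "x i" B] B by (simp add: x d3[simplified])
    qed
    ultimately show ?l
      using subspace_dim_equal[of "span {v (i + 2), v (i + 3), v (i + 4)}" "matrix_correlation B (x i)"]
        subspace_matrix_correlation by auto
  qed
  show ?thesis
    \<comment> \<open>The condition with offset 4 at \<open>i\<close> is, by symmetry of
      \<open>B\<close>, the one with offset 2 at \<open>i + 4\<close>.\<close>
    unfolding hp eq_iff correlates_hexagon_def
    using inner_symmetric_matrix[OF B(1)] B(1) hexagon_index_simps(3) by metis
qed

text \<open>Nonzero multiples of a matrix define the same correlation, so uniqueness up to a factor
  is what the definite description requires.\<close>

lemma associated_correlation_matrix:
  assumes v: "any_four_independent v" and x: "\<And>i. x i = span {v i}"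
  obtains B where "correlates_hexagon v B" "invertible B" "associated_correlation x = matrix_correlation B"
proof -
  obtain B0 where B0: "correlates_hexagon v B0" "invertible B0"
    and uniq: "\<And>B. correlates_hexagon v B \<Longrightarrow> \<exists>c. B = c *\<^sub>R B0"
    using correlation_matrix_unique[OF v] by blast
  have symB: "transpose B = B" if "correlates_hexagon v B" for B
    using that by (simp add: correlates_hexagon_def)
  have "associated_correlation x = matrix_correlation B0"
    unfolding associated_correlation_def
  proof (rule the_equality)
    show "(\<exists>B. transpose B = B \<and> invertible B \<and> matrix_correlation B0 = matrix_correlation B) \<and>
        (\<forall>i. matrix_correlation B0 (x i) = hexagon_plane x (i + 3))"
      using B0 symB matrix_correlation_vertex_iff[OF v x] by blast
  next
    fix \<kappa>
    assume \<kappa>: "(\<exists>B. transpose B = B \<and> invertible B \<and> \<kappa> = matrix_correlation B) \<and>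
        (\<forall>i. \<kappa> (x i) = hexagon_plane x (i + 3))"
    then obtain B where B: "transpose B = B" "invertible B" "\<kappa> = matrix_correlation B"
      by blast
    then have "correlates_hexagon v B"
      using \<kappa> matrix_correlation_vertex_iff[OF v x] by blast
    then obtain c where c: "B = c *\<^sub>R B0"
      using uniq by blast
    \<comment> \<open>With factor zero, \<open>B\<close> would be the zero matrix and not
      injective.\<close>
    have "c \<noteq> 0"
    proof
      assume "c = 0"
      with c have "B *v x = B *v y" for x y
        by simp
      with invertible_imp_inj[OF B(2)] have "(x :: real ^ 4) = y" for x y
        by (simp add: inj_def)
      from this[of 0 1] show False
        by simp
    qed
    then show "\<kappa> = matrix_correlation B0"
      by (auto simp: fun_eq_iff B(3) c matrix_correlation_def simp flip: scaleR_matrix_vector_assoc)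
  qed
  with B0 that show ?thesis by blast
qed

lemma hexagon_edge_vertices:
  assumes "\<And>i. x i = span {v i}"
  shows "hexagon_edge x i = span {v i, v (i + 1)}"
proof -
  have "span {v i} \<union> span {v (i + 1)} \<subseteq> span {v i, v (i + 1)}"
    by (simp add: span_mono)
  moreover have "{v i, v (i + 1)} \<subseteq> span (span {v i} \<union> span {v (i + 1)})"
    by (auto intro: span_base)
  ultimately show ?thesis
    unfolding hexagon_edge_def assms span_eq by simp
qed

text \<open>The vertices \<open>i + 3\<close> and \<open>i + 4\<close> lie in the images of both
  \<open>x i\<close> and \<open>x (i + 1)\<close>; they span a line, as does the intersection of
  these images.\<close>

lemma matrix_correlation_edge:
  assumes v: "any_four_independent v" and x: "\<And>i. x i = span {v i}"
    and B: "correlates_hexagon v B" "invertible B"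
  shows "matrix_correlation B (hexagon_edge x i) = hexagon_edge x (i + 3)"
proof -
  have B': "v (i + 2) \<bullet> (B *v v i) = 0" "v (i + 3) \<bullet> (B *v v i) = 0" "v (i + 4) \<bullet> (B *v v i) = 0" for i
    using B(1) inner_symmetric_matrix[of B] hexagon_index_simps(3) unfolding correlates_hexagon_def by metis+
  have "proj_line (matrix_correlation B (hexagon_edge x i))"
    unfolding hexagon_edge_vertices[OF x]
    by (intro proj_line_matrix_correlation B(2)) (simp add: proj_line_span_iff any_four_independent_dim2[OF v])
  moreover have "v (i + 3) \<in> matrix_correlation B (hexagon_edge x i)"
      "v (i + 4) \<in> matrix_correlation B (hexagon_edge x i)"
    using B'[of i] B'[of "i + 1"]
    by (simp_all add: hexagon_edge_vertices[OF x] matrix_correlation_span hexagon_index_simps)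
  ultimately show ?thesis
    using any_four_independent_dim2[OF v, of "i + 3" "i + 4"]
    by (simp add: proj_line_eqI hexagon_edge_vertices[OF x] hexagon_index_simps)
qed

subsection \<open>Duality of bivectors\<close>

text \<open>Complementary index pairs are exchanged with the appropriate sign. Only entries above
  the diagonal are read, so the result is skew for every \<open>L\<close>.\<close>

definition hodge :: "real ^ 4 ^ 4 \<Rightarrow> real ^ 4 ^ 4" where
  "hodge L = vec4
     (vec4 0 (L $ 2 $ 3) (- L $ 1 $ 3) (L $ 1 $ 2))
     (vec4 (- L $ 2 $ 3) 0 (L $ 0 $ 3) (- L $ 0 $ 2))
     (vec4 (L $ 1 $ 3) (- L $ 0 $ 3) 0 (L $ 0 $ 1))
     (vec4 (- L $ 1 $ 2) (L $ 0 $ 2) (- L $ 0 $ 1) 0)"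

lemma transpose_hodge: "transpose (hodge L) = - hodge L"
  by (simp add: transpose_eq_uminus_iff_4 hodge_def)

lemma inner_skew_pluecker:
  assumes "transpose L = - L"
  shows "p \<bullet> (L *v q) = L $ 0 $ 1 * pluecker p q 0 1 + L $ 0 $ 2 * pluecker p q 0 2 + L $ 0 $ 3 * pluecker p q 0 3 +
    L $ 1 $ 2 * pluecker p q 1 2 + L $ 1 $ 3 * pluecker p q 1 3 + L $ 2 $ 3 * pluecker p q 2 3"
  using assms unfolding transpose_eq_uminus_iff_4
  by (simp add: inner_4 matrix_vector_mult_4 pluecker_def algebra_simps)

text \<open>This is an entry of the product of the skew matrices of the two bivectors. Expanding it
  leaves only terms with a factor among the four inner products.\<close>

lemma pluecker_orthogonal:
  assumes "y \<bullet> p = 0" "y \<bullet> q = 0" "z \<bullet> p = 0" "z \<bullet> q = 0"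
  shows "(\<Sum>k\<in>UNIV. pluecker y z i k * pluecker p q k j) = 0"
proof -
  have "(\<Sum>k\<in>UNIV. pluecker y z i k * pluecker p q k j) =
    y $ i * ((z \<bullet> p) * q $ j - (z \<bullet> q) * p $ j) - z $ i * ((y \<bullet> p) * q $ j - (y \<bullet> q) * p $ j)"
    unfolding sum_4_from_0 inner_4 pluecker_def by (simp only: algebra_simps)
  then show ?thesis using assms by simp
qed

lemma pluecker_antisym: "pluecker p q i i = 0" "pluecker p q 1 0 = - pluecker p q 0 1"
  "pluecker p q 2 0 = - pluecker p q 0 2" "pluecker p q 3 0 = - pluecker p q 0 3"
  "pluecker p q 2 1 = - pluecker p q 1 2" "pluecker p q 3 1 = - pluecker p q 1 3"
  "pluecker p q 3 2 = - pluecker p q 2 3"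
  by (simp_all add: pluecker_def)

text \<open>Proportionality of the bivectors \<open>y \<and> z\<close> and \<open>*(p \<and> q)\<close> is stated in cross-multiplied form below.\<close>

definition dual_pluecker :: "real ^ 4 \<Rightarrow> real ^ 4 \<Rightarrow> 4 \<Rightarrow> 4 \<Rightarrow> real" where
  "dual_pluecker p q i j = (let P = pluecker p q in vec4
     (vec4 0 (P 2 3) (- P 1 3) (P 1 2)) (vec4 (- P 2 3) 0 (P 0 3) (- P 0 2))
     (vec4 (P 1 3) (- P 0 3) 0 (P 0 1)) (vec4 (- P 1 2) (P 0 2) (- P 0 1) 0)) $ i $ j"

text \<open>If the bivector of \<open>y\<close>, \<open>z\<close> is a multiple of the dual of that
  of \<open>p\<close>, \<open>q\<close>, then the duals are related by the same factor, since the
  star is an involution; this gives the equation. The version without division also covers dependent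
  pairs: it is a linear consequence of the 16 relations of \<open>pluecker_orthogonal\<close>, with
  products of coordinates as unknowns.\<close>

lemma pluecker_dual:
  assumes "y \<bullet> p = 0" "y \<bullet> q = 0" "z \<bullet> p = 0" "z \<bullet> q = 0"
  shows "pluecker y z i j * pluecker p q m n = dual_pluecker p q i j * dual_pluecker y z m n"
proof -
  note * = pluecker_orthogonal[OF assms, unfolded sum_4_from_0]
  have "\<forall>i j m n. pluecker y z i j * pluecker p q m n = dual_pluecker p q i j * dual_pluecker y z m n"
    using *[of 0 0] *[of 0 1] *[of 0 2] *[of 0 3] *[of 1 0] *[of 1 1] *[of 1 2] *[of 1 3]
     *[of 2 0] *[of 2 1] *[of 2 2] *[of 2 3] *[of 3 0] *[of 3 1] *[of 3 2] *[of 3 3]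
    unfolding forall_4_from_0
    by (simp only: dual_pluecker_def Let_def vec4_nth pluecker_antisym mult_minus_left mult_minus_right
          minus_minus mult_zero_left mult_zero_right, simp only: mult.commute[of "pluecker p q _ _"],
        intro conjI; linarith)
  then show ?thesis by blast
qed

text \<open>If all minors vanish, dividing by a nonzero coordinate of \<open>p\<close> exhibits
  \<open>q\<close> as a multiple of \<open>p\<close>.\<close>

lemma pluecker_nonzero:
  assumes "dim {p, q} = 2"
  obtains i j where "pluecker p q i j \<noteq> 0"
proof -
  have "\<exists>i j. pluecker p q i j \<noteq> 0"
  proof (rule ccontr)
    assume "\<not> ?thesis"
    then have pq: "p $ i * q $ j = q $ i * p $ j" for i j
      by (simp add: pluecker_def mult.commute)
    have "p \<noteq> 0"
      using assms by (auto simp: dim_insert span_zero split: if_splits)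
    then obtain i where i: "p $ i \<noteq> 0"
      by (auto simp: vec_eq_iff)
    have "q = (q $ i / p $ i) *\<^sub>R p"
      using pq[of i] i by (simp add: vec_eq_iff field_simps)
    then have "q \<in> span {p}"
      by (metis span_base span_scale singletonI)
    then have "dim {q, p} \<le> 1"
      by (simp add: dim_insert)
    then show False
      using assms by (simp add: insert_commute)
  qed
  with that show ?thesis by blast
qed

lemma dual_pluecker_nonzero:
  assumes "dim {p, q} = 2"
  obtains i j where "dual_pluecker p q i j \<noteq> 0"
proof -
  have "\<exists>i j. dual_pluecker p q i j \<noteq> 0"
  proof (rule ccontr)
    assume "\<not> ?thesis"
    then have "\<forall>i j. dual_pluecker p q i j = 0" by blast
    then have "\<forall>i j. pluecker p q i j = 0"
      unfolding forall_4_from_0 by (simp add: dual_pluecker_def Let_def pluecker_antisym)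
    with pluecker_nonzero[OF assms] show False by metis
  qed
  with that show ?thesis by blast
qed

text \<open>The star is self-adjoint for the pairing of skew matrices with bivectors, so it can be
  moved from \<open>L\<close> to the line.\<close>

lemma inner_hodge_pluecker:
  "p \<bullet> (hodge L *v q) = L $ 0 $ 1 * dual_pluecker p q 0 1 + L $ 0 $ 2 * dual_pluecker p q 0 2 +
    L $ 0 $ 3 * dual_pluecker p q 0 3 + L $ 1 $ 2 * dual_pluecker p q 1 2 +
    L $ 1 $ 3 * dual_pluecker p q 1 3 + L $ 2 $ 3 * dual_pluecker p q 2 3"
  unfolding inner_skew_pluecker[OF transpose_hodge]
  by (simp add: hodge_def dual_pluecker_def Let_def)

text \<open>Summing \<open>pluecker_dual\<close> against the entries of \<open>L\<close> relates the
  complex of \<open>L\<close> on one line to that of \<open>hodge L\<close> on the orthogonal line.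
  A nonzero coordinate at \<open>m\<close>, \<open>n\<close> lets vanishing pass from one side to
  the other.\<close>

lemma inner_pluecker_dual:
  assumes "transpose L = - L"
    and "y \<bullet> p = 0" "y \<bullet> q = 0" "z \<bullet> p = 0" "z \<bullet> q = 0"
  shows "(y \<bullet> (L *v z)) * pluecker p q m n = (p \<bullet> (hodge L *v q)) * dual_pluecker y z m n"
  unfolding inner_skew_pluecker[OF assms(1)] inner_hodge_pluecker
  by (simp only: distrib_right mult.assoc pluecker_dual[OF assms(2-5)])

subsection \<open>The correlation acts within the complex\<close>

lemma complex_contains_hexagonI:
  assumes "transpose L = - L" "any_four_independent v" and x: "\<And>i. x i = span {v i}"
    and "\<forall>i. hexagon_edge x i \<in> linear_line_complex L"
  shows "complex_contains_hexagon v L"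
proof -
  have "v i \<bullet> (L *v v (i + 1)) = 0" for i
    using assms(4) span_base[of "v i" "{v i, v (i + 1)}"] span_base[of "v (i + 1)" "{v i, v (i + 1)}"]
    by (auto simp: linear_line_complex_def hexagon_edge_vertices[OF x])
  with assms(1) show ?thesis
    by (simp add: complex_contains_hexagon_def)
qed

lemma correlation_preserves_complex:
  assumes L: "L \<noteq> 0" "transpose L = - L"
    and x: "hexagon_in_general_position x" "\<forall>i. hexagon_edge x i \<in> linear_line_complex L"
    and l: "l \<in> linear_line_complex L"
  shows "line_image (associated_correlation x) l \<in> linear_line_complex L"
proof -
  obtain v where xv: "\<And>i. x i = span {v i}" and v: "any_four_independent v"
    by (rule hexagon_vertices[OF x(1)], rule that, assumption+)
  obtain B where B: "correlates_hexagon v B" "invertible B" "associated_correlation x = matrix_correlation B"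
    by (rule associated_correlation_matrix[OF v xv])
  have symB: "transpose B = B"
    using B(1) by (simp add: correlates_hexagon_def)
  have cL: "complex_contains_hexagon v L"
    by (rule complex_contains_hexagonI[OF L(2) v xv x(2)])
  \<comment> \<open>The skew form of this matrix on \<open>p\<close>, \<open>q\<close> is that of
    \<open>hodge L\<close> on \<open>B *v p\<close>, \<open>B *v q\<close>.\<close>
  let ?M = "transpose B ** hodge L ** B"
  have M: "p \<bullet> (?M *v q) = (B *v p) \<bullet> (hodge L *v (B *v q))" for p q
    by (simp only: inner_congruence)
  have "complex_contains_hexagon v ?M"
    unfolding complex_contains_hexagon_def
  proof (intro conjI allI)
    show "transpose ?M = - ?M"
      by (rule transpose_congruence_skew[OF transpose_hodge])
    fix i
    have e: "matrix_correlation B (hexagon_edge x i) = span {v (i + 3), v (i + 4)}"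
      using matrix_correlation_edge[OF v xv B(1,2)] hexagon_edge_vertices[OF xv, where i = "i + 3"] hexagon_index_simps(2) by simp
    have "v (i + 3) \<in> matrix_correlation B (hexagon_edge x i)" "v (i + 4) \<in> matrix_correlation B (hexagon_edge x i)"
      by (simp_all add: e span_base)
    then have orth: "v (i + 3) \<bullet> (B *v v i) = 0" "v (i + 3) \<bullet> (B *v v (i + 1)) = 0"
        "v (i + 4) \<bullet> (B *v v i) = 0" "v (i + 4) \<bullet> (B *v v (i + 1)) = 0"
      by (simp_all add: hexagon_edge_vertices[OF xv] matrix_correlation_span)
    \<comment> \<open>The opposite edge belongs to the complex of \<open>L\<close> and is orthogonal
      to the \<open>B\<close>-image of edge \<open>i\<close>, so duality makes
      \<open>hodge L\<close> vanish on that image.\<close>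
    have "v (i + 3) \<bullet> (L *v v (i + 4)) = 0"
      using cL unfolding complex_contains_hexagon_def by (metis hexagon_index_simps(2))
    moreover have "dim {v (i + 3), v (i + 4)} = 2"
      by (simp add: any_four_independent_dim2[OF v])
    then obtain m n where "dual_pluecker (v (i + 3)) (v (i + 4)) m n \<noteq> 0"
      by (rule dual_pluecker_nonzero)
    ultimately show "v i \<bullet> (?M *v v (i + 1)) = 0"
      unfolding M using inner_pluecker_dual[OF L(2) orth, of m n] by simp
  qed
  then obtain c where c: "?M = c *\<^sub>R L"
    using complex_matrix_unique[OF v cL _ L(1)] by blast
  have line: "proj_line l"
    using l by (simp add: linear_line_complex_def)
  then obtain p q where pq: "l = span {p, q}" "dim {p, q} = 2"
    by (rule proj_lineE)
  have "dim {B *v p, B *v q} = 2"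
    using dim_image_invertible[OF B(2), of "{p, q}"] pq(2) by simp
  then obtain i j where ij: "pluecker (B *v p) (B *v q) i j \<noteq> 0"
    by (rule pluecker_nonzero)
  have "p \<bullet> (L *v q) = 0"
    using l span_base[of _ "{p, q}"] by (simp add: linear_line_complex_def pq(1))
  \<comment> \<open>As \<open>?M\<close> is a multiple of \<open>L\<close>, it vanishes on
    \<open>l\<close>, so \<open>hodge L\<close> vanishes on the \<open>B\<close>-image of
    \<open>l\<close>. Duality then carries this to the orthogonal line, which is the image of
    \<open>l\<close> under the correlation.\<close>
  then have Mpq: "(B *v p) \<bullet> (hodge L *v (B *v q)) = 0"
    unfolding M[symmetric] c by (simp flip: scaleR_matrix_vector_assoc)
  have "y \<bullet> (L *v z) = 0" if "y \<in> matrix_correlation B l" "z \<in> matrix_correlation B l" for y z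
    using inner_pluecker_dual[OF L(2), of y "B *v p" "B *v q" z i j] that Mpq ij
    by (simp add: pq(1) matrix_correlation_span)
  moreover have "proj_line (matrix_correlation B l)"
    using line B(2) by (rule proj_line_matrix_correlation)
  moreover have "line_image (associated_correlation x) l = matrix_correlation B l"
    using line by (simp add: B(3) line_image_matrix_correlation proj_line_def)
  ultimately show ?thesis
    by (simp add: linear_line_complex_def)
qed

subsection \<open>Oriented circles\<close>

lemma in_span_pair: "x \<in> span {p, q} \<longleftrightarrow> (\<exists>a b. x = a *\<^sub>R p + b *\<^sub>R q)"
  by (auto simp: span_insert span_singleton algebra_simps)

lemma pluecker_combination:
  "pluecker (a *\<^sub>R p + b *\<^sub>R q) (c *\<^sub>R p + d *\<^sub>R q) i j = (a * d - b * c) * pluecker p q i j"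
  by (simp add: pluecker_def algebra_simps)

lemma complex_coords_combination:
  "complex_coords (a *\<^sub>R p + b *\<^sub>R q) (c *\<^sub>R p + d *\<^sub>R q) = (a * d - b * c) *\<^sub>R complex_coords p q"
  by (simp add: complex_coords_def pluecker_combination)

lemma line_circle_span: "line_circle \<phi> (span {p, q}) = \<phi> ` span {complex_coords p q}"
proof -
  let ?S = "{complex_coords \<alpha> \<beta> | \<alpha> \<beta>. \<alpha> \<in> span {p, q} \<and> \<beta> \<in> span {p, q}}"
  have "?S \<subseteq> span {complex_coords p q}"
    unfolding in_span_pair by (auto simp: complex_coords_combination span_base span_scale)
  moreover have "{complex_coords p q} \<subseteq> ?S"
    using span_base[of _ "{p, q}"] by auto
  ultimately have "span ?S = span {complex_coords p q}"
    by (intro subset_antisym span_mono span_minimal subspace_span)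
  then show ?thesis
    by (simp add: line_circle_def)
qed

section \<open>The symplectic form of the circle complex\<close>

definition circle_complex_matrix :: "real ^ 4 ^ 4" where
  "circle_complex_matrix = vec4 (vec4 0 0 0 1) (vec4 0 0 (- 1) 0) (vec4 0 1 0 0) (vec4 (- 1) 0 0 0)"

lemma circle_complex_matrix_skew: "transpose circle_complex_matrix = - circle_complex_matrix"
  by (simp add: transpose_eq_uminus_iff_4 circle_complex_matrix_def)

lemma circle_complex_matrix_nonzero: "circle_complex_matrix \<noteq> 0"
  by (simp add: vec_eq_iff_4 circle_complex_matrix_def)

lemma invertible_circle_complex_matrix: "invertible circle_complex_matrix"
proof -
  have "x = 0" if "circle_complex_matrix *v x = 0" for x
    using that by (simp add: vec_eq_iff_4 matrix_vector_mult_4 circle_complex_matrix_def)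
  then show ?thesis
    by (simp add: invertible_left_inverse matrix_left_invertible_ker)
qed

lemma inner_circle_complex_matrix:
  "p \<bullet> (circle_complex_matrix *v q) = pluecker p q 0 3 - pluecker p q 1 2"
  by (simp add: inner_4 matrix_vector_mult_4 circle_complex_matrix_def pluecker_def algebra_simps)

lemma circle_complex_eq: "circle_complex = linear_line_complex circle_complex_matrix"
  by (simp add: circle_complex_def linear_line_complex_def inner_circle_complex_matrix)

lemma circle_complex_span_iff:
  "span {p, q} \<in> circle_complex \<longleftrightarrow> dim {p, q} = 2 \<and> pluecker p q 0 3 = pluecker p q 1 2"
proof -
  have "pluecker \<alpha> \<beta> 0 3 = pluecker \<alpha> \<beta> 1 2"
    if "\<alpha> \<in> span {p, q}" "\<beta> \<in> span {p, q}" "pluecker p q 0 3 = pluecker p q 1 2" for \<alpha> \<beta>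
    using that unfolding in_span_pair by (auto simp: pluecker_combination)
  moreover have "p \<in> span {p, q}" "q \<in> span {p, q}"
    by (simp_all add: span_base)
  ultimately show ?thesis
    unfolding circle_complex_def proj_line_span_iff[symmetric] mem_Collect_eq by blast
qed

lemma circle_complexE:
  assumes "L \<in> circle_complex"
  obtains p q where "L = span {p, q}" "dim {p, q} = 2" "pluecker p q 0 3 = pluecker p q 1 2"
proof -
  have "proj_line L"
    using assms by (simp add: circle_complex_def)
  then obtain p q where "L = span {p, q}"
    by (rule proj_lineE)
  with assms that show ?thesis
    by (simp add: circle_complex_span_iff)
qed

text \<open>Lines of the complex are the Lagrangian planes of a symplectic form: isotropic of
  dimension 2 in dimension 4, hence equal to their own polars.\<close>

lemma circle_complex_self_polar:
  assumes "L \<in> circle_complex"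
  shows "matrix_correlation circle_complex_matrix L = L"
proof -
  have L: "subspace L" "dim L = 2"
    using assms by (auto simp: circle_complex_def proj_line_def)
  have "L \<subseteq> matrix_correlation circle_complex_matrix L"
    using assms by (auto simp: circle_complex_eq linear_line_complex_def matrix_correlation_def)
  then show ?thesis
    using subspace_dim_equal[of L "matrix_correlation circle_complex_matrix L"] L
      dim_matrix_correlation[OF L(1) invertible_circle_complex_matrix]
    by (simp add: subspace_matrix_correlation)
qed

lemma pluecker_form_scaleR:
  "pluecker_form (a *\<^sub>R v) (b *\<^sub>R w) = a * b * pluecker_form v w"
  by (cases v; cases w) (simp add: algebra_simps)

lemma pluecker_form_complex_coords:
  assumes "pluecker p q 0 3 = pluecker p q 1 2" "pluecker r s 0 3 = pluecker r s 1 2"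
  shows "pluecker_form (complex_coords p q) (complex_coords r s) =
    (p \<bullet> (circle_complex_matrix *v r)) * (q \<bullet> (circle_complex_matrix *v s)) -
    (p \<bullet> (circle_complex_matrix *v s)) * (q \<bullet> (circle_complex_matrix *v r))"
proof -
  \<comment> \<open>For arbitrary pairs the determinant is the polarised Klein form plus the product
    of the two defects from the complex. On the complex the defects vanish, and the 03 and 12 terms
    merge into twice the product of the last coordinates.\<close>
  have "(p \<bullet> (circle_complex_matrix *v r)) * (q \<bullet> (circle_complex_matrix *v s)) -
    (p \<bullet> (circle_complex_matrix *v s)) * (q \<bullet> (circle_complex_matrix *v r)) =
    pluecker p q 0 1 * pluecker r s 2 3 + pluecker p q 2 3 * pluecker r s 0 1
    - pluecker p q 0 2 * pluecker r s 1 3 - pluecker p q 1 3 * pluecker r s 0 2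
    + pluecker p q 0 3 * pluecker r s 1 2 + pluecker p q 1 2 * pluecker r s 0 3
    + (pluecker p q 0 3 - pluecker p q 1 2) * (pluecker r s 0 3 - pluecker r s 1 2)"
    unfolding inner_circle_complex_matrix pluecker_def by (simp only: algebra_simps)
  then show ?thesis
    using assms by (simp add: complex_coords_def algebra_simps)
qed

text \<open>
  A singular \<open>2 \<times> 2\<close> pairing between the lines gives a point of the first that is conjugate to the
  whole second line; it lies on the second line, as that line is its own polar.
\<close>

lemma circle_complex_meet_iff:
  assumes "span {p, q} \<in> circle_complex" "span {r, s} \<in> circle_complex"
  shows "pluecker_form (complex_coords p q) (complex_coords r s) = 0 \<longleftrightarrow>
    (\<exists>x. x \<noteq> 0 \<and> x \<in> span {p, q} \<and> x \<in> span {r, s})"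
proof
  let ?\<omega> = "\<lambda>x y. x \<bullet> (circle_complex_matrix *v y)"
  have pq: "dim {p, q} = 2" "pluecker p q 0 3 = pluecker p q 1 2"
    and rs: "dim {r, s} = 2" "pluecker r s 0 3 = pluecker r s 1 2"
    using assms by (simp_all add: circle_complex_span_iff)
  note form = pluecker_form_complex_coords[OF pq(2) rs(2)]
  {
    assume "pluecker_form (complex_coords p q) (complex_coords r s) = 0"
    then have det: "?\<omega> p r * ?\<omega> q s = ?\<omega> p s * ?\<omega> q r"
      by (simp add: form)
    \<comment> \<open>A nonzero left kernel vector of the singular matrix of \<omega>-values is read
      off from a nonzero column, and is arbitrary if both columns vanish.\<close>
    obtain a b where ab: "a \<noteq> 0 \<or> b \<noteq> 0" "a * ?\<omega> p r + b * ?\<omega> q r = 0" "a * ?\<omega> p s + b * ?\<omega> q s = 0"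
    proof (cases "?\<omega> p r = 0 \<and> ?\<omega> q r = 0")
      case True
      show ?thesis
      proof (cases "?\<omega> p s = 0 \<and> ?\<omega> q s = 0")
        case True
        with \<open>?\<omega> p r = 0 \<and> ?\<omega> q r = 0\<close> show ?thesis
          using that[of 1 0] by simp
      next
        case False
        with \<open>?\<omega> p r = 0 \<and> ?\<omega> q r = 0\<close> show ?thesis
          using that[of "?\<omega> q s" "- ?\<omega> p s"] by (auto simp: mult.commute)
      qed
    next
      case False
      then show ?thesis
        using that[of "?\<omega> q r" "- ?\<omega> p r"] det by (auto simp: algebra_simps)
    qed
    let ?x = "a *\<^sub>R p + b *\<^sub>R q"
    have "?x \<in> matrix_correlation circle_complex_matrix (span {r, s})"
      using ab by (simp add: matrix_correlation_span inner_add_left)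
    then have "?x \<in> span {r, s}"
      using circle_complex_self_polar[OF assms(2)] by simp
    moreover have "?x \<in> span {p, q}"
      by (auto simp: in_span_pair)
    moreover have "?x \<noteq> 0"
    proof
      assume x0: "?x = 0"
      \<comment> \<open>By Cramer's rule, a linear relation between \<open>p\<close> and
        \<open>q\<close> has coefficients annihilated by every minor.\<close>
      have "a * pluecker p q i j = 0 \<and> b * pluecker p q i j = 0" for i j
      proof -
        have "a * p $ n + b * q $ n = 0" for n
          using arg_cong[OF x0, of "\<lambda>x. x $ n"] by simp
        from this[of i] this[of j] show ?thesis
          unfolding pluecker_def by algebra
      qed
      moreover obtain i j where "pluecker p q i j \<noteq> 0"
        by (rule pluecker_nonzero[OF pq(1)])
      ultimately show False
        using ab(1) by (metis mult_eq_0_iff)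
    qed
    ultimately show "\<exists>x. x \<noteq> 0 \<and> x \<in> span {p, q} \<and> x \<in> span {r, s}"
      by blast
  }
  assume "\<exists>x. x \<noteq> 0 \<and> x \<in> span {p, q} \<and> x \<in> span {r, s}"
  then obtain x where x: "x \<noteq> 0" "x \<in> span {p, q}" "x \<in> span {r, s}"
    by blast
  have lines: "proj_line (span {p, q})" "proj_line (span {r, s})"
    by (simp_all add: proj_line_span_iff pq rs)
  \<comment> \<open>Both lines are respanned starting with the common point \<open>x\<close>. Since
    \<open>x\<close> is conjugate to itself and to \<open>s'\<close>, the first row of the pairing
    vanishes.\<close>
  obtain q' where q': "span {p, q} = span {x, q'}"
    by (rule proj_line_through[OF lines(1) x(2,1)])
  obtain s' where s': "span {r, s} = span {x, s'}"
    by (rule proj_line_through[OF lines(2) x(3,1)])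
  have "p \<in> span {x, q'}" "q \<in> span {x, q'}" "r \<in> span {x, s'}" "s \<in> span {x, s'}"
    using q' s' span_base[of _ "{p, q}"] span_base[of _ "{r, s}"] by auto
  then obtain k l where "complex_coords p q = k *\<^sub>R complex_coords x q'"
      "complex_coords r s = l *\<^sub>R complex_coords x s'"
    unfolding in_span_pair by (metis complex_coords_combination)
  moreover have "pluecker_form (complex_coords x q') (complex_coords x s') = 0"
  proof -
    have "pluecker x q' 0 3 = pluecker x q' 1 2" "pluecker x s' 0 3 = pluecker x s' 1 2"
      using assms unfolding q' s' by (simp_all add: circle_complex_span_iff)
    then show ?thesis
      by (simp add: pluecker_form_complex_coords) (simp add: inner_circle_complex_matrix pluecker_def)
  qed
  ultimately show "pluecker_form (complex_coords p q) (complex_coords r s) = 0"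
    by (simp add: pluecker_form_scaleR)
qed

text \<open>Nondegeneracy of \<open>pluecker_form\<close>, tested on the five unit vectors, gives
  injectivity; equality of dimensions gives surjectivity.\<close>

lemma lie_isometryD:
  assumes "lie_isometry \<phi>"
  shows "linear \<phi>" "inj \<phi>" "surj \<phi>" "lie_form (\<phi> v) (\<phi> w) = pluecker_form v w"
proof -
  show lin: "linear \<phi>" and form: "lie_form (\<phi> v) (\<phi> w) = pluecker_form v w" for v w
    using assms unfolding lie_isometry_def by blast+
  have "v = 0" if "\<phi> v = 0" for v
  proof -
    have "lie_form 0 (\<phi> w) = 0" for w
      by (cases "\<phi> w") (simp add: zero_prod_def)
    with that have *: "pluecker_form v w = 0" for w
      by (simp flip: form)
    obtain p q s t u where v: "v = (p, q, s, t, u)"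
      by (cases v)
    show ?thesis
      using *[of "(1, 0, 0, 0, 0)"] *[of "(0, 1, 0, 0, 0)"] *[of "(0, 0, 1, 0, 0)"]
        *[of "(0, 0, 0, 1, 0)"] *[of "(0, 0, 0, 0, 1)"]
      by (simp add: v zero_prod_def)
  qed
  then show "inj \<phi>"
    by (simp add: linear_injective_0[OF lin])
  with lin show "surj \<phi>"
    by (rule linear_injective_imp_surjective) simp
qed

lemma touches_line_circle_span:
  assumes "lie_isometry \<phi>"
  shows "touches (line_circle \<phi> (span {p, q})) (line_circle \<phi> (span {r, s})) \<longleftrightarrow>
    pluecker_form (complex_coords p q) (complex_coords r s) = 0"
proof -
  have "\<phi> (complex_coords p q) \<in> \<phi> ` span {complex_coords p q}"
    "\<phi> (complex_coords r s) \<in> \<phi> ` span {complex_coords r s}"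
    by (simp_all add: span_base)
  then show ?thesis
    unfolding touches_def line_circle_span
    by (auto simp: span_singleton lie_isometryD(4)[OF assms] pluecker_form_scaleR)
qed

lemma touches_line_circle_iff:
  assumes "lie_isometry \<phi>" "L \<in> circle_complex" "M \<in> circle_complex"
  shows "touches (line_circle \<phi> L) (line_circle \<phi> M) \<longleftrightarrow> (\<exists>x. x \<noteq> 0 \<and> x \<in> L \<and> x \<in> M)"
proof -
  obtain p q where L: "L = span {p, q}"
    using assms(2) by (rule circle_complexE)
  obtain r s where M: "M = span {r, s}"
    using assms(3) by (rule circle_complexE)
  show ?thesis
    using circle_complex_meet_iff assms(2,3) unfolding L M touches_line_circle_span[OF assms(1)] by blast
qed

section \<open>Bijection between lines of the complex and oriented circles\<close>

lemma pluecker_nonzero_dim: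
  assumes "pluecker p q i j \<noteq> 0"
  shows "dim {p, q} = 2"
proof -
  have "q \<noteq> 0"
    using assms by (auto simp: pluecker_def)
  moreover have "p \<notin> span {q}"
    using assms by (auto simp: pluecker_def span_singleton)
  ultimately show ?thesis
    by (simp add: dim_insert)
qed

text \<open>\<open>complex_coords\<close> omits the coordinate 12, which the equation of the complex
  recovers from 03.\<close>

lemma pluecker_zero:
  assumes "complex_coords p q = 0" "pluecker p q 0 3 = pluecker p q 1 2"
  shows "pluecker p q i j = 0"
proof -
  have "\<forall>i j. pluecker p q i j = 0"
    unfolding forall_4_from_0 using assms by (simp add: complex_coords_def pluecker_antisym zero_prod_def)
  then show ?thesis by blast
qed

lemma complex_coords_nonzero:
  assumes "span {p, q} \<in> circle_complex"
  shows "complex_coords p q \<noteq> 0"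
  using assms pluecker_zero pluecker_nonzero by (metis circle_complex_span_iff)

text \<open>The vector lies on the Lie quadric because a line meets itself, so its circle touches
  itself.\<close>

lemma oriented_circle_line_circle:
  assumes "lie_isometry \<phi>" "L \<in> circle_complex"
  shows "oriented_circle (line_circle \<phi> L)"
proof -
  obtain p q where L: "L = span {p, q}" and pq: "dim {p, q} = 2"
    using assms(2) by (rule circle_complexE)
  have "p \<noteq> 0"
    using pq by (auto simp: dim_insert span_zero split: if_splits)
  moreover have "p \<in> L"
    by (simp add: L span_base)
  ultimately have "touches (line_circle \<phi> L) (line_circle \<phi> L)"
    using touches_line_circle_iff[OF assms(1,2,2)] by blast
  moreover have "dim (line_circle \<phi> L) = 1"
    unfolding L line_circle_span
    using complex_coords_nonzero assms(2) L lie_isometryD(1,2)[OF assms(1)]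
    by (subst dim_image_eq) (auto intro: inj_on_subset)
  moreover have "subspace (line_circle \<phi> L)"
    unfolding L line_circle_span by (intro linear_subspace_image lie_isometryD(1)[OF assms(1)]) simp
  ultimately show ?thesis
    by (simp add: oriented_circle_def touches_def)
qed

text \<open>The rows of the skew matrix of the bivector span its line, and proportional matrices
  have proportional rows.\<close>

lemma pluecker_determines_line:
  assumes "dim {p, q} = 2" "dim {r, s} = 2" "\<And>i j. pluecker p q i j = k * pluecker r s i j"
  shows "span {p, q} = span {r, s}"
proof -
  have row: "p $ i *\<^sub>R q - q $ i *\<^sub>R p \<in> span {r, s}" for i
  proof -
    have "p $ i *\<^sub>R q - q $ i *\<^sub>R p = (- k * s $ i) *\<^sub>R r + (k * r $ i) *\<^sub>R s"
      using assms(3)[of i] by (simp add: vec_eq_iff pluecker_def algebra_simps)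
    then show ?thesis
      unfolding in_span_pair by blast
  qed
  obtain i j where ij: "pluecker p q i j \<noteq> 0"
    by (rule pluecker_nonzero[OF assms(1)])
  have "pluecker p q i j *\<^sub>R p = p $ j *\<^sub>R (p $ i *\<^sub>R q - q $ i *\<^sub>R p) - p $ i *\<^sub>R (p $ j *\<^sub>R q - q $ j *\<^sub>R p)"
    "pluecker p q i j *\<^sub>R q = q $ j *\<^sub>R (p $ i *\<^sub>R q - q $ i *\<^sub>R p) - q $ i *\<^sub>R (p $ j *\<^sub>R q - q $ j *\<^sub>R p)"
    by (simp_all add: pluecker_def algebra_simps)
  then have "pluecker p q i j *\<^sub>R p \<in> span {r, s}" "pluecker p q i j *\<^sub>R q \<in> span {r, s}"
    using row by (simp_all only: span_diff span_scale)
  then have "p \<in> span {r, s}" "q \<in> span {r, s}"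
    using span_scale[of _ "{r, s}" "inverse (pluecker p q i j)"] ij by fastforce+
  then show ?thesis
    using proj_line_eqI[of "span {r, s}" p q] assms(1,2) by (simp add: proj_line_span_iff)
qed

lemma line_circle_inj:
  assumes "lie_isometry \<phi>" "L \<in> circle_complex" "M \<in> circle_complex" "line_circle \<phi> L = line_circle \<phi> M"
  shows "L = M"
proof -
  obtain p q where L: "L = span {p, q}" and pq: "dim {p, q} = 2" "pluecker p q 0 3 = pluecker p q 1 2"
    using assms(2) by (rule circle_complexE)
  obtain r s where M: "M = span {r, s}" and rs: "dim {r, s} = 2" "pluecker r s 0 3 = pluecker r s 1 2"
    using assms(3) by (rule circle_complexE)
  have "span {complex_coords p q} = span {complex_coords r s}"
    using assms(4) lie_isometryD(2)[OF assms(1)] unfolding L M line_circle_span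
    by (simp add: inj_image_eq_iff)
  then have "complex_coords p q \<in> span {complex_coords r s}"
    using span_base[of "complex_coords p q" "{complex_coords p q}"] by simp
  then obtain k where k: "complex_coords p q = k *\<^sub>R complex_coords r s"
    by (auto simp: span_singleton)
  have "\<forall>i j. pluecker p q i j = k * pluecker r s i j"
    unfolding forall_4_from_0 using k pq(2) rs(2) by (simp add: complex_coords_def pluecker_antisym)
  then show ?thesis
    unfolding L M using pluecker_determines_line[OF pq(1) rs(1)] by blast
qed

lemma line_circle_surj:
  assumes "lie_isometry \<phi>" "oriented_circle C"
  obtains L where "L \<in> circle_complex" "line_circle \<phi> L = C"
proof -
  have C: "subspace C" "dim C = 1" "\<forall>V\<in>C. lie_form V V = 0"
    using assms(2) by (auto simp: oriented_circle_def)
  obtain V where V: "V \<noteq> 0" "C = span {V}"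
    by (rule subspace_dim_1E[OF C(1,2)])
  obtain v where v: "V = \<phi> v"
    using lie_isometryD(3)[OF assms(1)] by (metis surjD)
  obtain p q s t u where vt: "v = (p, q, s, t, u)"
    by (cases v)
  \<comment> \<open>Being null is the Pluecker relation for a bivector whose coordinates 03 and 12
    both equal \<open>u\<close>.\<close>
  have rel: "u * u = s * t - p * q"
  proof -
    have "V \<in> C"
      by (simp add: V(2) span_base)
    then have "pluecker_form v v = 0"
      using C(3) lie_isometryD(4)[OF assms(1), of v v] by (simp add: v)
    then show ?thesis
      by (simp add: vt algebra_simps)
  qed
  have "v \<noteq> 0"
    using V(1) v linear_0[OF lie_isometryD(1)[OF assms(1)]] by auto
  \<comment> \<open>The skew matrix with Pluecker coordinates \<open>v\<close> has rank 2, and its rows span the line.\<close>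
  define G :: "real ^ 4 ^ 4" where
    "G = vec4 (vec4 0 p s u) (vec4 (- p) 0 u t) (vec4 (- s) (- u) 0 q) (vec4 (- u) (- t) (- q) 0)"
  have line: thesis if "G $ i $ j \<noteq> 0" "complex_coords (G $ i) (G $ j) = G $ i $ j *\<^sub>R v"
    "pluecker (G $ i) (G $ j) 1 2 = G $ i $ j * u" for i j
  proof -
    have eq: "pluecker (G $ i) (G $ j) 0 3 = pluecker (G $ i) (G $ j) 1 2"
      using that(2,3) by (simp add: complex_coords_def vt)
    have "complex_coords (G $ i) (G $ j) \<noteq> 0"
      using that(1,2) \<open>v \<noteq> 0\<close> by simp
    then obtain m n where "pluecker (G $ i) (G $ j) m n \<noteq> 0"
      by (auto simp: complex_coords_def zero_prod_def)
    then have "span {G $ i, G $ j} \<in> circle_complex"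
      using eq by (simp add: circle_complex_span_iff pluecker_nonzero_dim)
    moreover have "line_circle \<phi> (span {G $ i, G $ j}) = C"
    proof -
      have "span {G $ i $ j *\<^sub>R v} = span {v}"
        using span_image_scale[of "{v}" "\<lambda>_. G $ i $ j"] that(1) by simp
      then show ?thesis
        unfolding line_circle_span that(2) V(2) v
        using span_linear_image[OF lie_isometryD(1)[OF assms(1)], of "{v}"] by simp
    qed
    ultimately show thesis
      by (rule \<open>\<And>L. L \<in> circle_complex \<Longrightarrow> line_circle \<phi> L = C \<Longrightarrow> thesis\<close>)
  qed
  \<comment> \<open>By the Pluecker relation, the bivector of rows \<open>i\<close> and
    \<open>j\<close> is \<open>G $ i $ j\<close> times the original one. The five index pairs run
    through all coordinates of \<open>v\<close>, so one of them has a nonzero entry.\<close>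
  have minors: "complex_coords (G $ i) (G $ j) = G $ i $ j *\<^sub>R v \<and> pluecker (G $ i) (G $ j) 1 2 = G $ i $ j * u"
    if "(i, j) \<in> {(0, 1), (2, 3), (0, 2), (1, 3), (0, 3)}" for i j
    using that by (auto simp: complex_coords_def pluecker_def G_def vt rel algebra_simps)
  have "G $ 0 $ 1 \<noteq> 0 \<or> G $ 2 $ 3 \<noteq> 0 \<or> G $ 0 $ 2 \<noteq> 0 \<or> G $ 1 $ 3 \<noteq> 0 \<or> G $ 0 $ 3 \<noteq> 0"
    using \<open>v \<noteq> 0\<close> by (auto simp: vt G_def zero_prod_def)
  then show thesis
    using line[of 0 1] line[of 2 3] line[of 0 2] line[of 1 3] line[of 0 3] minors by auto
qed

lemma circle_line_line_circle:
  assumes "lie_isometry \<phi>" "L \<in> circle_complex"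
  shows "circle_line \<phi> (line_circle \<phi> L) = L"
  unfolding circle_line_def by (rule the_equality) (use assms line_circle_inj in blast)+

lemma circle_line:
  assumes "lie_isometry \<phi>" "oriented_circle C"
  shows "circle_line \<phi> C \<in> circle_complex" "line_circle \<phi> (circle_line \<phi> C) = C"
proof -
  obtain L where "L \<in> circle_complex" "line_circle \<phi> L = C"
    by (rule line_circle_surj[OF assms])
  with circle_line_line_circle[OF assms(1)] show
    "circle_line \<phi> C \<in> circle_complex" "line_circle \<phi> (circle_line \<phi> C) = C"
    by auto
qed

lemma touches_iff_lines_meet:
  assumes "lie_isometry \<phi>" "oriented_circle C" "oriented_circle C'"
  shows "touches C C' \<longleftrightarrow> (\<exists>x. x \<noteq> 0 \<and> x \<in> circle_line \<phi> C \<and> x \<in> circle_line \<phi> C')"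
  using touches_line_circle_iff[OF assms(1) circle_line(1)[OF assms(1,2)] circle_line(1)[OF assms(1,3)]]
  by (simp add: circle_line(2)[OF assms(1)] assms(2,3))

subsection \<open>The eighth circle\<close>

text \<open>Both images lie in the image of the point \<open>x\<close>, of dimension 3, where two
  subspaces of dimension 2 must meet.\<close>

lemma correlation_images_meet:
  assumes "invertible B" "proj_line L" "proj_line M" "x \<noteq> 0" "x \<in> L" "x \<in> M"
  shows "\<exists>y. y \<noteq> 0 \<and> y \<in> matrix_correlation B L \<and> y \<in> matrix_correlation B M"
proof (rule ccontr)
  let ?L = "matrix_correlation B L" and ?M = "matrix_correlation B M"
  assume "\<not> ?thesis"
  then have "?L \<inter> ?M \<subseteq> {0}"
    by auto
  then have "dim (?L \<inter> ?M) = 0"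
    by simp
  moreover have "dim {y + z | y z. y \<in> ?L \<and> z \<in> ?M} + dim (?L \<inter> ?M) = dim ?L + dim ?M"
    by (intro dim_sums_Int subspace_matrix_correlation)
  moreover have "dim ?L = 2" "dim ?M = 2"
    using proj_line_matrix_correlation assms(1-3) by (auto simp: proj_line_def)
  moreover have "{y + z | y z. y \<in> ?L \<and> z \<in> ?M} \<subseteq> matrix_correlation B (span {x})"
    using assms(5,6) unfolding matrix_correlation_span
    by (auto simp: matrix_correlation_def inner_add_left)
  then have "dim {y + z | y z. y \<in> ?L \<and> z \<in> ?M} \<le> dim (matrix_correlation B (span {x}))"
    by (rule dim_subset)
  moreover have "dim (matrix_correlation B (span {x})) + dim (span {x}) = 4"
    by (intro dim_matrix_correlation assms(1)) simp
  moreover have "dim (span {x}) = 1"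
    using assms(4) by simp
  ultimately show False
    by linarith
qed

text \<open>The vertices \<open>i\<close> and \<open>i + 1\<close> both lie on the line of
  \<open>C i\<close>, and general position makes them distinct points.\<close>

lemma hexagon_edge_circle_hexagon:
  assumes x: "hexagon_in_general_position (circle_hexagon \<phi> C)" and L: "\<And>i. proj_line (circle_line \<phi> (C i))"
  shows "hexagon_edge (circle_hexagon \<phi> C) i = circle_line \<phi> (C i)"
proof -
  obtain v where xv: "\<And>i. circle_hexagon \<phi> C i = span {v i}" and v: "any_four_independent v"
    by (rule hexagon_vertices[OF x], rule that, assumption+)
  have "v j \<in> circle_line \<phi> (C (j - 1)) \<inter> circle_line \<phi> (C j)" for j
    using xv[of j] span_base[of "v j" "{v j}"] by (simp add: circle_hexagon_def)
  from this[of i] this[of "i + 1"] have "v i \<in> circle_line \<phi> (C i)" "v (i + 1) \<in> circle_line \<phi> (C i)"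
    by simp_all
  moreover have "dim {v i, v (i + 1)} = 2"
    by (simp add: any_four_independent_dim2[OF v])
  ultimately show ?thesis
    using proj_line_eqI[OF L] by (simp add: hexagon_edge_vertices[OF xv])
qed

lemma eighth_circle:
  assumes \<phi>: "lie_isometry \<phi>" and c: "oriented_circle c" and C: "\<And>i. oriented_circle (C i)"
    and x: "hexagon_in_general_position (circle_hexagon \<phi> C)"
  defines "\<kappa> \<equiv> associated_correlation (circle_hexagon \<phi> C)"
  shows "\<exists>!c'. maps_circle \<phi> \<kappa> c c'"
    and "maps_circle \<phi> \<kappa> c c' \<Longrightarrow> touches c (C i) \<Longrightarrow> touches c' (C (i + 3))"
proof -
  let ?x = "circle_hexagon \<phi> C" and ?l = "circle_line \<phi>"
  have edge: "hexagon_edge ?x i = ?l (C i)" for i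
    using x circle_line(1)[OF \<phi> C] by (intro hexagon_edge_circle_hexagon) (auto simp: circle_complex_def)
  have lc: "?l c \<in> circle_complex" "proj_line (?l c)"
    using circle_line(1)[OF \<phi> c] by (auto simp: circle_complex_def)
  have image: "line_image \<kappa> (?l c) \<in> circle_complex"
    unfolding circle_complex_eq \<kappa>_def
  proof (rule correlation_preserves_complex[OF circle_complex_matrix_nonzero circle_complex_matrix_skew x])
    show "\<forall>i. hexagon_edge ?x i \<in> linear_line_complex circle_complex_matrix"
      using circle_line(1)[OF \<phi> C] by (simp add: edge circle_complex_eq)
    show "?l c \<in> linear_line_complex circle_complex_matrix"
      using lc by (simp add: circle_complex_eq)
  qed
  \<comment> \<open>The image line belongs to the circle complex, whose lines correspond bijectively
    to oriented circles.\<close>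
  show "\<exists>!c'. maps_circle \<phi> \<kappa> c c'"
  proof
    show "maps_circle \<phi> \<kappa> c (line_circle \<phi> (line_image \<kappa> (?l c)))"
      by (simp add: maps_circle_def oriented_circle_line_circle circle_line_line_circle \<phi> image)
    show "c' = line_circle \<phi> (line_image \<kappa> (?l c))" if "maps_circle \<phi> \<kappa> c c'" for c'
      using that circle_line(2)[OF \<phi>] by (simp add: maps_circle_def)
  qed
  obtain v where xv: "\<And>i. ?x i = span {v i}" and v: "any_four_independent v"
    by (rule hexagon_vertices[OF x], rule that, assumption+)
  obtain B where B: "correlates_hexagon v B" "invertible B" "associated_correlation ?x = matrix_correlation B"
    by (rule associated_correlation_matrix[OF v xv])
  assume "maps_circle \<phi> \<kappa> c c'" and touch: "touches c (C i)"
  then have c': "oriented_circle c'" "?l c' = matrix_correlation B (?l c)"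
    using lc(2) by (auto simp: maps_circle_def \<kappa>_def B(3) line_image_matrix_correlation proj_line_def)
  have Ci: "?l (C (i + 3)) = matrix_correlation B (?l (C i))"
    using matrix_correlation_edge[OF v xv B(1,2), of i] by (simp add: edge)
  obtain y where y: "y \<noteq> 0" "y \<in> ?l c" "y \<in> ?l (C i)"
    using touch touches_iff_lines_meet[OF \<phi> c C] by blast
  have "proj_line (?l (C i))"
    using circle_line(1)[OF \<phi> C] by (simp add: circle_complex_def)
  then show "touches c' (C (i + 3))"
    unfolding touches_iff_lines_meet[OF \<phi> c'(1) C] c'(2) Ci
    by (rule correlation_images_meet[OF B(2) lc(2) _ y])
qed

theorem theorem4p5:
  "(\<forall>(\<Lambda> :: real ^ 4 ^ 4) (x :: 6 \<Rightarrow> (real ^ 4) set).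
      \<Lambda> \<noteq> 0 \<and> transpose \<Lambda> = - \<Lambda> \<and>
      hexagon_in_general_position x \<and>
      (\<forall>i. hexagon_edge x i \<in> linear_line_complex \<Lambda>) \<longrightarrow>
      (\<forall>l \<in> linear_line_complex \<Lambda>.
         line_image (associated_correlation x) l \<in> linear_line_complex \<Lambda>))
   \<and>
   (\<forall>(\<phi> :: real5 \<Rightarrow> real5) c c1 c2 c3 c12 c23 c13 hex.
      lie_isometry \<phi> \<and>
      oriented_circle c \<and> oriented_circle c1 \<and> oriented_circle c2 \<and> oriented_circle c3 \<and>
      oriented_circle c12 \<and> oriented_circle c23 \<and> oriented_circle c13 \<and>
      touches c c1 \<and> touches c c2 \<and> touches c c3 \<and>
      touches c12 c1 \<and> touches c12 c2 \<and>
      touches c23 c2 \<and> touches c23 c3 \<and>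
      touches c13 c1 \<and> touches c13 c3 \<and>
      hex = circle_hexagon \<phi> (cyclic6 c1 c12 c2 c23 c3 c13) \<and>
      hexagon_in_general_position hex \<longrightarrow>
      (\<exists>!c123. maps_circle \<phi> (associated_correlation hex) c c123) \<and>
      (\<forall>c123. maps_circle \<phi> (associated_correlation hex) c c123 \<longrightarrow>
         touches c123 c12 \<and> touches c123 c23 \<and> touches c123 c13))"
proof (rule conjI; intro allI impI; (elim conjE)?)
  fix \<Lambda> :: "real ^ 4 ^ 4" and x :: "6 \<Rightarrow> (real ^ 4) set"
  assume "\<Lambda> \<noteq> 0" "transpose \<Lambda> = - \<Lambda>" "hexagon_in_general_position x"
    "\<forall>i. hexagon_edge x i \<in> linear_line_complex \<Lambda>"
  then show "\<forall>l \<in> linear_line_complex \<Lambda>. line_image (associated_correlation x) l \<in> linear_line_complex \<Lambda>"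
    using correlation_preserves_complex by blast
next
  fix \<phi> :: "real5 \<Rightarrow> real5" and c c1 c2 c3 c12 c23 c13 :: "real5 set" and hex
  let ?C = "cyclic6 c1 c12 c2 c23 c3 c13"
  assume \<phi>: "lie_isometry \<phi>" and c: "oriented_circle c"
    and circles: "oriented_circle c1" "oriented_circle c2" "oriented_circle c3"
      "oriented_circle c12" "oriented_circle c23" "oriented_circle c13"
    and touch: "touches c c1" "touches c c2" "touches c c3"
    and hex: "hex = circle_hexagon \<phi> ?C" and gp: "hexagon_in_general_position hex"
  have C: "?C 0 = c1" "?C 1 = c12" "?C 2 = c2" "?C 3 = c23" "?C 4 = c3" "?C 5 = c13"
    by (simp_all add: cyclic6_def)
  have "\<forall>i. oriented_circle (?C i)"
    unfolding forall_6 C using circles by blast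
  then have oriented: "oriented_circle (?C i)" for i
    by blast
  note eighth = eighth_circle[OF \<phi> c oriented gp[unfolded hex], folded hex]
  \<comment> \<open>The circles \<open>c3\<close>, \<open>c1\<close>, \<open>c2\<close> have
    positions 4, 0, 2; the opposite positions 1, 3, 5 carry \<open>c12\<close>, \<open>c23\<close>,
    \<open>c13\<close>.\<close>
  have "touches c123 c12" "touches c123 c23" "touches c123 c13"
    if "maps_circle \<phi> (associated_correlation hex) c c123" for c123
    using eighth(2)[OF that, of 4] eighth(2)[OF that, of 0] eighth(2)[OF that, of 2] touch
    unfolding add_6 C by blast+
  with eighth(1) show "(\<exists>!c123. maps_circle \<phi> (associated_correlation hex) c c123) \<and>
      (\<forall>c123. maps_circle \<phi> (associated_correlation hex) c c123 \<longrightarrow>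
         touches c123 c12 \<and> touches c123 c23 \<and> touches c123 c13)"
    by blast
qed

end
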